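(* Let $\mathcal X_1,\dots,\mathcal X_n$ and $\mathcal Y$ be continuous sets, $\mathcal X=\prod_{i\in[n]}\mathcal X_i$, and let $(\mathcal X,p(y|x),\mathcal Y)$ be a privacy channel given by conditional density functions $p(y|x)$. For each $i\in[n]$ let $$\mathbb Q_i=\{(\mathcal X_i,p(y|x_i),\mathcal Y): p(x_{(i)}|x_i)\in\mathbb P\}$$ be the set of all possible channels of the form $$p(y|x_i)=\int_{x_{(i)}}p(y|x_i,x_{(i)})\,p(x_{(i)}|x_i)\,dx_{(i)},\qquad x_i\in\mathcal X_i,\ y\in\mathcal Y,$$ and let $$\mathbb S_i=\{(\mathcal X_i,p(y|x_i),\mathcal Y): \text{for each } x_i \text{ there exists } x_{(i)} \text{ such that } p(y|x_i)=p(y|x_i,x_{(i)}) \text{ for all } y\}.$$ Assume that the individual channel capacity $C_1$ of the privacy channel $(\mathcal X,p(y|x),\mathcal Y)$ with respect to $\mathbb P$, defined as $$C_1=\max_{i\in[n],\,X\in\mathbb P}I(X_i;Y)=\max_{i\in[n]}\ \max_{p(y|x_i)\in\mathbb Q_i}\ \max_{p(x_i)\in\mathbb P_i}I(X_i;Y),$$ exists, and assume that the function $p(y|x)$ is continuous on $\mathcal Y\times\mathcal X$. Then $\mathbb S_i\subseteq\mathbb Q_i$ and $$C_1=\max_{i\in[n]}\ \max_{p(y|x_i)\in\mathbb S_i}\ \max_{p(x_i)\in\mathbb P_i}I(X_i;Y).$$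
   Context: Here $n\ge1$ and $[n]=\{1,\dots,n\}$. The random vector $X=(X_1,\dots,X_n)$ takes values in $\mathcal X$, with $X_i$ taking values in $\mathcal X_i$; $X$, the $X_i$ and the channel output $Y$ (with values in $\mathcal Y$) are continuous random variables, and all the related probability distributions are given by the corresponding density functions. $\mathcal X_{(i)}=\prod_{j\ne i}\mathcal X_j$, $X_{(i)}=(X_1,\dots,X_{i-1},X_{i+1},\dots,X_n)$, $x_{(i)}\in\mathcal X_{(i)}$ denotes $x=(x_1,\dots,x_n)$ with its $i$-th coordinate removed, and $p(y|x_i,x_{(i)})$ means $p(y|x)$. A privacy channel $(\mathcal X,p(y|x),\mathcal Y)$ (of a query function $f:\mathcal X\to\mathcal Y$) gives for each dataset $x\in\mathcal X$ the probability density $p(y|x)$ of observing the output $y\in\mathcal Y$ when $x$ is queried. $\mathbb P$ and $\mathbb P_i$ denote the universes of probability distributions (given by densities) over $\mathcal X$ and $\mathcal X_i$, respectively; $X\in\mathbb P$ means that the distribution of $X$ is in $\mathbb P$, and $p(x_i)$ is the density of $X_i$. The notation $p(x_{(i)}|x_i)\in\mathbb P$ means that there exists $X\in\mathbb P$ such that $X\sim p(x_i)\,p(x_{(i)}|x_i)$. The mutual information is $$I(X_i;Y)=\int_{x_i,y}p(x_i)\,p(y|x_i)\log\frac{p(y|x_i)}{\int_{x_i'}p(y|x_i')\,p(x_i')\,dx_i'}\,dx_i\,dy.$$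
   Formalization: Distributions in P and P_i and the conditionals p(x_(i)|x_i) are arbitrary Borel probability measures (Dirac masses allowed) instead of densities, since with densities S_i ⊆ Q_i fails; the X_i are nonempty F_sigma subsets of a Euclidean space, and Y is a Borel subset of one. *)

theory Defs
  imports "HOL-Probability.Probability"
begin

text \<open>
  Datasets are extensional functions on \<open>{1..n}\<close>; \<open>\<X> i\<close> is the value set of the \<open>i\<close>-th record,
  and \<open>data_space \<X> J\<close> is the space of partial datasets with index set \<open>J\<close>.  The dataset composed
  of \<open>x = x\<^sub>i\<close> and \<open>z = x\<^sub>(\<^sub>i\<^sub>)\<close> is \<open>z(i := x)\<close>.  The sets \<open>\<X> i\<close> share an ambient Euclidean space; since
  no Lebesgue measure is used on it, sets of smaller dimension can simply be embedded.

  Probability distributions on the dataset side are arbitrary Borel probability measures,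
  i.e. \<open>p(x) dx\<close> is written \<open>P(dx)\<close>.  In other words, densities are understood in the generalized
  sense that admits Dirac deltas.  This is needed for deterministic conditional distributions
  \<open>p(x\<^sub>(\<^sub>i\<^sub>)|x\<^sub>i)\<close> to qualify; with Lebesgue densities only, the inclusion of the selection channels in
  the averaged channels fails (e.g. for \<open>p(y|x\<^sub>1,x\<^sub>2)\<close> normal with mean \<open>x\<^sub>2\<close> and variance 1, a proper
  mixture over \<open>x\<^sub>2\<close> is never exactly normal with variance 1).  Channel outputs have densities with
  respect to Lebesgue measure.
\<close>

definition record_space :: "(nat \<Rightarrow> 'a::euclidean_space set) \<Rightarrow> nat \<Rightarrow> 'a measure" where
  "record_space \<X> i = restrict_space borel (\<X> i)"

definition data_space :: "(nat \<Rightarrow> 'a::euclidean_space set) \<Rightarrow> nat set \<Rightarrow> (nat \<Rightarrow> 'a) measure" where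
  "data_space \<X> J = PiM J (record_space \<X>)"

definition output_space :: "'b::euclidean_space set \<Rightarrow> 'b measure" where
  "output_space \<Y> = restrict_space lborel \<Y>"

definition prob_dists :: "'x measure \<Rightarrow> 'x measure set" where
  "prob_dists M = {\<mu>. prob_space \<mu> \<and> sets \<mu> = sets M}"

text \<open>\<open>q x y\<close> stands for \<open>q(y|x)\<close>; only its values on \<open>space M \<times> \<Y>\<close> matter.\<close>

definition is_channel ::
  "'x measure \<Rightarrow> 'b::euclidean_space set \<Rightarrow> ('x \<Rightarrow> 'b \<Rightarrow> real) \<Rightarrow> bool" where
  "is_channel M \<Y> q \<longleftrightarrow>
     (\<lambda>(x, y). q x y) \<in> borel_measurable (M \<Otimes>\<^sub>M output_space \<Y>) \<and>
     (\<forall>x\<in>space M. (\<forall>y\<in>\<Y>. 0 \<le> q x y) \<and> (\<integral>\<^sup>+ y. ennreal (q x y) \<partial>output_space \<Y>) = 1)"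

text \<open>
  \<open>I(X\<^sub>i;Y)\<close> for \<open>X\<^sub>i \<sim> \<mu>\<close> and the channel \<open>q\<close>, with logarithms to base \<open>b\<close>.  It is the extended
  integral, positive part minus negative part, because the value may be \<open>\<infinity>\<close>, whereas a Bochner
  integral would silently be 0 there.  The integral of the negative part is always finite, so the
  difference is never \<open>\<infinity> - \<infinity>\<close>.
\<close>

definition info_density ::
  "real \<Rightarrow> 'x measure \<Rightarrow> ('x \<Rightarrow> 'b \<Rightarrow> real) \<Rightarrow> 'x \<Rightarrow> 'b \<Rightarrow> real" where
  "info_density b \<mu> q x y = q x y * log b (q x y / (\<integral>x'. q x' y \<partial>\<mu>))"

definition mutual_info ::
  "real \<Rightarrow> 'b::euclidean_space set \<Rightarrow> 'x measure \<Rightarrow> ('x \<Rightarrow> 'b \<Rightarrow> real) \<Rightarrow> ereal" where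
  "mutual_info b \<Y> \<mu> q =
     enn2ereal (\<integral>\<^sup>+ (x, y). ennreal (info_density b \<mu> q x y) \<partial>(\<mu> \<Otimes>\<^sub>M output_space \<Y>)) -
     enn2ereal (\<integral>\<^sup>+ (x, y). ennreal (- info_density b \<mu> q x y) \<partial>(\<mu> \<Otimes>\<^sub>M output_space \<Y>))"

text \<open>\<open>X \<sim> p(x\<^sub>i) p(x\<^sub>(\<^sub>i\<^sub>)|x\<^sub>i)\<close>: \<open>P\<close> is the law of \<open>X\<close>, \<open>\<mu>\<close> that of \<open>X\<^sub>i\<close>, and \<open>\<kappa>\<close> a
  (regular) conditional distribution of \<open>X\<^sub>(\<^sub>i\<^sub>)\<close> given \<open>X\<^sub>i\<close>.\<close>

definition factorizes ::
  "nat \<Rightarrow> (nat \<Rightarrow> 'a::euclidean_space set) \<Rightarrow> nat \<Rightarrow> (nat \<Rightarrow> 'a) measure \<Rightarrow> 'a measure \<Rightarrow>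
   ('a \<Rightarrow> (nat \<Rightarrow> 'a) measure) \<Rightarrow> bool" where
  "factorizes n \<X> i P \<mu> \<kappa> \<longleftrightarrow>
     \<mu> \<in> prob_dists (record_space \<X> i) \<and>
     \<kappa> \<in> record_space \<X> i \<rightarrow>\<^sub>M prob_algebra (data_space \<X> ({1..n} - {i})) \<and>
     P = \<mu> \<bind> (\<lambda>x. distr (\<kappa> x) (data_space \<X> {1..n}) (\<lambda>z. z(i := x)))"

text \<open>\<open>q(y|x\<^sub>i) = \<integral> p(y|x\<^sub>i,x\<^sub>(\<^sub>i\<^sub>)) p(x\<^sub>(\<^sub>i\<^sub>)|x\<^sub>i) dx\<^sub>(\<^sub>i\<^sub>)\<close>.  For each \<open>x\<^sub>i\<close> the integral is finite for almost
  every \<open>y\<close>; on the remaining null set the density \<open>q(\<cdot>|x\<^sub>i)\<close> is 0.\<close>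

definition averages_to ::
  "(nat \<Rightarrow> 'a::euclidean_space set) \<Rightarrow> 'b::euclidean_space set \<Rightarrow> ((nat \<Rightarrow> 'a) \<Rightarrow> 'b \<Rightarrow> real) \<Rightarrow>
   nat \<Rightarrow> ('a \<Rightarrow> (nat \<Rightarrow> 'a) measure) \<Rightarrow> ('a \<Rightarrow> 'b \<Rightarrow> real) \<Rightarrow> bool" where
  "averages_to \<X> \<Y> p i \<kappa> q \<longleftrightarrow>
     is_channel (record_space \<X> i) \<Y> q \<and>
     (\<forall>x\<in>\<X> i. \<forall>y\<in>\<Y>. q x y = (\<integral>z. p (z(i := x)) y \<partial>\<kappa> x))"

definition averaged_channels ::
  "nat \<Rightarrow> (nat \<Rightarrow> 'a::euclidean_space set) \<Rightarrow> 'b::euclidean_space set \<Rightarrow>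
   ((nat \<Rightarrow> 'a) \<Rightarrow> 'b \<Rightarrow> real) \<Rightarrow> nat \<Rightarrow> ('a \<Rightarrow> 'b \<Rightarrow> real) set" where
  "averaged_channels n \<X> \<Y> p i =
     {q. \<exists>P \<mu> \<kappa>. P \<in> prob_dists (data_space \<X> {1..n}) \<and> factorizes n \<X> i P \<mu> \<kappa> \<and>
                averages_to \<X> \<Y> p i \<kappa> q}"

definition selection_channels ::
  "nat \<Rightarrow> (nat \<Rightarrow> 'a::euclidean_space set) \<Rightarrow> 'b::euclidean_space set \<Rightarrow>
   ((nat \<Rightarrow> 'a) \<Rightarrow> 'b \<Rightarrow> real) \<Rightarrow> nat \<Rightarrow> ('a \<Rightarrow> 'b \<Rightarrow> real) set" where
  "selection_channels n \<X> \<Y> p i =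
     {q. is_channel (record_space \<X> i) \<Y> q \<and>
         (\<forall>x\<in>\<X> i. \<exists>z\<in>PiE ({1..n} - {i}) \<X>. \<forall>y\<in>\<Y>. q x y = p (z(i := x)) y)}"

definition is_max_of :: "'c::order \<Rightarrow> 'c set \<Rightarrow> bool" where
  "is_max_of m S \<longleftrightarrow> m \<in> S \<and> (\<forall>s\<in>S. s \<le> m)"

text \<open>The values \<open>I(X\<^sub>i;Y)\<close> with \<open>i \<in> [n]\<close> and \<open>X\<close> ranging over all distributions on \<open>\<X>\<close>.\<close>

definition individual_infos ::
  "real \<Rightarrow> nat \<Rightarrow> (nat \<Rightarrow> 'a::euclidean_space set) \<Rightarrow> 'b::euclidean_space set \<Rightarrow>
   ((nat \<Rightarrow> 'a) \<Rightarrow> 'b \<Rightarrow> real) \<Rightarrow> ereal set" where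
  "individual_infos b n \<X> \<Y> p =
     {mutual_info b \<Y> \<mu> q | i P \<mu> \<kappa> q. i \<in> {1..n} \<and> P \<in> prob_dists (data_space \<X> {1..n}) \<and>
        factorizes n \<X> i P \<mu> \<kappa> \<and> averages_to \<X> \<Y> p i \<kappa> q}"

text \<open>The values \<open>I(X\<^sub>i;Y)\<close> with \<open>i \<in> [n]\<close>, \<open>p(y|x\<^sub>i) \<in> \<C> i\<close> and, independently, \<open>p(x\<^sub>i)\<close> an
  arbitrary distribution on \<open>\<X> i\<close>.\<close>

definition channel_infos ::
  "real \<Rightarrow> nat \<Rightarrow> (nat \<Rightarrow> 'a::euclidean_space set) \<Rightarrow> 'b::euclidean_space set \<Rightarrow>
   (nat \<Rightarrow> ('a \<Rightarrow> 'b \<Rightarrow> real) set) \<Rightarrow> ereal set" where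
  "channel_infos b n \<X> \<Y> \<C> =
     {mutual_info b \<Y> \<mu> q | i \<mu> q. i \<in> {1..n} \<and> q \<in> \<C> i \<and> \<mu> \<in> prob_dists (record_space \<X> i)}"

text \<open>The two expressions for the individual channel capacity range over the same values.\<close>

lemma kernel_compose_prob:
  assumes i: "i \<in> {1..n}" and \<mu>: "\<mu> \<in> prob_dists (record_space \<X> i)"
    and \<kappa>[measurable]: "\<kappa> \<in> record_space \<X> i \<rightarrow>\<^sub>M prob_algebra (data_space \<X> ({1..n} - {i}))"
  shows "\<mu> \<bind> (\<lambda>x. distr (\<kappa> x) (data_space \<X> {1..n}) (\<lambda>z. z(i := x)))
           \<in> prob_dists (data_space \<X> {1..n})"
proof -
  let ?M = "record_space \<X> i" and ?J = "{1..n} - {i}"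
  have J: "insert i ?J = {1..n}" using i by auto
  have "(\<lambda>(z, x). z(i := x)) \<in> data_space \<X> ?J \<Otimes>\<^sub>M ?M \<rightarrow>\<^sub>M data_space \<X> {1..n}"
    using measurable_add_dim[of i ?J "record_space \<X>"] unfolding data_space_def J .
  from measurable_compose[OF measurable_pair_swap' this]
  have upd: "(\<lambda>(x, z). z(i := x)) \<in> ?M \<Otimes>\<^sub>M data_space \<X> ?J \<rightarrow>\<^sub>M data_space \<X> {1..n}"
    by (simp add: case_prod_beta')
  have K: "(\<lambda>x. distr (\<kappa> x) (data_space \<X> {1..n}) (\<lambda>z. z(i := x)))
             \<in> ?M \<rightarrow>\<^sub>M prob_algebra (data_space \<X> {1..n})"
    using measurable_distr_prob_space2[OF \<kappa> upd] .
  have "\<mu> \<in> space (prob_algebra ?M)"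
    using \<mu> by (simp add: prob_dists_def space_prob_algebra)
  from prob_space_bind'[OF this K] sets_bind'[OF this K]
  show ?thesis by (simp add: prob_dists_def)
qed

lemma individual_infos_eq_channel_infos:
  "individual_infos b n \<X> \<Y> p = channel_infos b n \<X> \<Y> (averaged_channels n \<X> \<Y> p)"
proof (intro equalityI subsetI)
  fix v assume "v \<in> individual_infos b n \<X> \<Y> p"
  then show "v \<in> channel_infos b n \<X> \<Y> (averaged_channels n \<X> \<Y> p)"
    unfolding individual_infos_def channel_infos_def averaged_channels_def factorizes_def by blast
next
  fix v assume "v \<in> channel_infos b n \<X> \<Y> (averaged_channels n \<X> \<Y> p)"
  then obtain i \<mu> q \<kappa> where v: "v = mutual_info b \<Y> \<mu> q" and i: "i \<in> {1..n}"
    and \<mu>: "\<mu> \<in> prob_dists (record_space \<X> i)"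
    and \<kappa>: "\<kappa> \<in> record_space \<X> i \<rightarrow>\<^sub>M prob_algebra (data_space \<X> ({1..n} - {i}))"
    and q: "averages_to \<X> \<Y> p i \<kappa> q"
    unfolding channel_infos_def averaged_channels_def factorizes_def by blast
  let ?P = "\<mu> \<bind> (\<lambda>x. distr (\<kappa> x) (data_space \<X> {1..n}) (\<lambda>z. z(i := x)))"
  have "?P \<in> prob_dists (data_space \<X> {1..n})" "factorizes n \<X> i ?P \<mu> \<kappa>"
    using kernel_compose_prob[OF i \<mu> \<kappa>] \<mu> \<kappa> by (auto simp: factorizes_def)
  with v i q show "v \<in> individual_infos b n \<X> \<Y> p"
    unfolding individual_infos_def by blast
qed

end

theory Submission
  imports Defs
begin

text \<open>
  Selection channels are averaged channels with Dirac conditional distributions; the required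
  measurable selectors exist because the matching partial datasets form a \<open>\<sigma>\<close>-compact set for
  each \<open>x\<^sub>i\<close>.

  For the maximum, let \<open>(\<mu>, q)\<close> attain the capacity, where \<open>q\<close> averages \<open>p\<close> over \<open>\<kappa>\<close>, and let \<open>r\<close> be the
  output density.  Mutual information is convex in the channel, so it lies above its linearization
  at \<open>q\<close>: \<open>I(q') \<ge> \<integral> \<mu>(dx) \<integral> q'(y|x) log (q(y|x) / r(y)) dy\<close>.  The inner integral is affine in
  \<open>q'(\<cdot>|x)\<close>, so for almost every \<open>x\<close> a \<open>\<kappa>(x)\<close>-positive set of partial datasets \<open>z\<close> gives at least the
  value of the average \<open>q(\<cdot>|x)\<close>.  Inner regularity replaces these sets by a countable union of
  compact sets, from which \<open>z\<close> can be chosen measurably, and the resulting selection channel has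
  mutual information at least that of \<open>q\<close>.
\<close>

section \<open>Measurable selection\<close>

text \<open>Subsets of a second countable space are separable: a point of \<open>S\<close> is chosen
  in each basic open set that meets \<open>S\<close>. The sequence stays inside \<open>S\<close>, so
  that functions defined or continuous only on \<open>S\<close> can be evaluated along it.\<close>

lemma dense_sequence_in:
  fixes S :: "'a::{metric_space, second_countable_topology} set"
  assumes "S \<noteq> {}"
  obtains d :: "nat \<Rightarrow> 'a" where "range d \<subseteq> S" "\<And>x e. x \<in> S \<Longrightarrow> e > 0 \<Longrightarrow> \<exists>k. dist (d k) x < e"
proof -
  obtain B :: "'a set set" where B: "countable B" "topological_basis B"
    using ex_countable_basis by blast
  define T where "T = (\<lambda>b. SOME t. t \<in> b \<inter> S) ` {b \<in> B. b \<inter> S \<noteq> {}}"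
  have sel: "(SOME t. t \<in> b \<inter> S) \<in> b \<inter> S" if "b \<inter> S \<noteq> {}" for b
    using that someI_ex[of "\<lambda>t. t \<in> b \<inter> S"] by blast
  have T: "countable T" "T \<subseteq> S" using B(1) sel unfolding T_def by (simp, blast)
  have dense: "\<exists>t\<in>T. dist t x < e" if "x \<in> S" "e > 0" for x e
  proof -
    obtain b where b: "b \<in> B" "x \<in> b" "b \<subseteq> ball x e"
      using topological_basisE[OF B(2), of "ball x e" x] \<open>e > 0\<close> by auto
    then have "b \<inter> S \<noteq> {}" using that by auto
    from sel[OF this] b have "dist (SOME t. t \<in> b \<inter> S) x < e"
      by (metis IntD1 dist_commute mem_ball subsetD)
    with b \<open>b \<inter> S \<noteq> {}\<close> show ?thesis unfolding T_def by blast
  qed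
  obtain x where "x \<in> S" using assms by auto
  from dense[OF this zero_less_one] have ne: "T \<noteq> {}" by auto
  show thesis
  proof (rule that[of "from_nat_into T"])
    show "range (from_nat_into T) \<subseteq> S" using from_nat_into[OF ne] T(2) by auto
    fix x and e :: real assume "x \<in> S" "e > 0"
    then obtain t where "t \<in> T" "dist t x < e"
      using dense by blast
    then show "\<exists>k. dist (from_nat_into T k) x < e"
      using from_nat_into_surj[OF T(1)] by metis
  qed
qed

text \<open>Minimizing successively the distance to each point of a dense sequence cuts every compact value
  down to a single point.\<close>

lemma measurable_selection_compact:
  fixes F :: "'x \<Rightarrow> 'z::{metric_space, second_countable_topology} set"
  assumes compact: "\<And>x. x \<in> space M \<Longrightarrow> compact (F x)"
    and hit: "\<And>C. closed C \<Longrightarrow> {x \<in> space M. F x \<inter> C \<noteq> {}} \<in> sets M"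
  obtains s where "s \<in> borel_measurable M" "\<And>x. x \<in> space M \<Longrightarrow> F x \<noteq> {} \<Longrightarrow> s x \<in> F x"
proof -
  obtain d :: "nat \<Rightarrow> 'z" where d: "\<And>x e. e > 0 \<Longrightarrow> \<exists>k. dist (d k) x < e"
    using dense_sequence_in[of "UNIV :: 'z set"] by auto
  define G where "G = rec_nat F (\<lambda>k H x. {z \<in> H x. \<forall>w\<in>H x. dist z (d k) \<le> dist w (d k)})"
  have G0: "G 0 = F" and GS: "G (Suc k) x = {z \<in> G k x. \<forall>w\<in>G k x. dist z (d k) \<le> dist w (d k)}" for k x
    by (auto simp: G_def)
  have cG: "compact (G k x)" if "x \<in> space M" for k x
  proof (induction k)
    case 0 then show ?case using compact that by (simp add: G0)
  next
    case (Suc k)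
    have "G (Suc k) x = G k x \<inter> (\<Inter>w\<in>G k x. {z. dist z (d k) \<le> dist w (d k)})"
      by (auto simp: GS)
    moreover have "closed (\<Inter>w\<in>G k x. {z. dist z (d k) \<le> dist w (d k)})"
      by (intro closed_INT ballI closed_Collect_le continuous_intros)
    ultimately show ?case using Suc by (simp add: compact_Int_closed)
  qed
  have min: "\<exists>z\<in>G k x \<inter> C. \<forall>w\<in>G k x \<inter> C. dist z (d k) \<le> dist w (d k)"
    if "x \<in> space M" "closed C" "G k x \<inter> C \<noteq> {}" for k x C
  proof -
    have "compact (G k x \<inter> C)" using cG that by (simp add: compact_Int_closed)
    then show ?thesis
      by (rule continuous_attains_inf[OF _ that(3)]) (intro continuous_intros)
  qed
  have hG: "{x \<in> space M. G k x \<inter> C \<noteq> {}} \<in> sets M" if "closed C" for k C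
    using that
  proof (induction k arbitrary: C)
    case 0 then show ?case using hit by (simp add: G0)
  next
    case (Suc k)
    let ?B = "\<lambda>a :: rat. {z. dist z (d k) \<le> of_rat a}"
    have cB: "closed (?B a)" for a by (intro closed_Collect_le continuous_intros)
    \<comment> \<open>The new stage meets \<open>C\<close> iff the distance to \<open>d k\<close>
      has the same minimum on \<open>G k x\<close> and on its part in \<open>C\<close>. Equality of
      the two minima means that no rational \<open>a\<close> separates them, a countable condition
      to which the induction hypothesis applies.\<close>
    have "G (Suc k) x \<inter> C \<noteq> {} \<longleftrightarrow>
        G k x \<inter> C \<noteq> {} \<and> (\<forall>a. G k x \<inter> ?B a \<noteq> {} \<longrightarrow> G k x \<inter> (C \<inter> ?B a) \<noteq> {})"
      if x: "x \<in> space M" for x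
    proof (intro iffI conjI allI impI)
      assume *: "G (Suc k) x \<inter> C \<noteq> {}"
      then show "G k x \<inter> C \<noteq> {}" by (auto simp: GS)
      fix a assume "G k x \<inter> ?B a \<noteq> {}"
      with * show "G k x \<inter> (C \<inter> ?B a) \<noteq> {}" by (fastforce simp: GS)
    next
      assume *: "G k x \<inter> C \<noteq> {} \<and> (\<forall>a. G k x \<inter> ?B a \<noteq> {} \<longrightarrow> G k x \<inter> (C \<inter> ?B a) \<noteq> {})"
      then obtain z where z: "z \<in> G k x \<inter> C" "\<And>w. w \<in> G k x \<inter> C \<Longrightarrow> dist z (d k) \<le> dist w (d k)"
        using min[OF x Suc.prems] by blast
      have "dist z (d k) \<le> dist w (d k)" if w: "w \<in> G k x" for w
      proof (rule ccontr)
        assume "\<not> ?thesis"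
        then obtain a where a: "dist w (d k) < of_rat a" "of_rat a < dist z (d k)"
          using of_rat_dense by (metis not_le)
        with w have "G k x \<inter> ?B a \<noteq> {}" by force
        with * obtain v where "v \<in> G k x \<inter> C" "dist v (d k) \<le> of_rat a" by blast
        with z(2)[of v] a show False by auto
      qed
      with z(1) show "G (Suc k) x \<inter> C \<noteq> {}" by (auto simp: GS)
    qed
    then have "{x \<in> space M. G (Suc k) x \<inter> C \<noteq> {}} =
        {x \<in> space M. G k x \<inter> C \<noteq> {} \<and>
           (\<forall>a. G k x \<inter> ?B a \<noteq> {} \<longrightarrow> G k x \<inter> (C \<inter> ?B a) \<noteq> {})}" by auto
    also have "\<dots> \<in> sets M"
      by (intro sets.sets_Collect Suc.IH closed_Int cB Suc.prems)
    finally show ?case .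
  qed
  \<comment> \<open>Cantor's intersection theorem, applied inside the compact set
    \<open>G 0 x \<inter> C\<close>. Keeping \<open>C\<close> general serves both the existence of
    the selected point and the measurability of the selection.\<close>
  have nest: "(\<Inter>k. G k x \<inter> C) \<noteq> {}"
    if "x \<in> space M" "closed C" "\<And>k. G k x \<inter> C \<noteq> {}" for x C
  proof (rule compact_space_imp_nest)
    show "compact_space (top_of_set (G 0 x \<inter> C))"
      using cG[OF that(1)] that(2) by (simp add: compact_space_subtopology compact_Int_closed)
    have mono: "G n x \<inter> C \<subseteq> G m x \<inter> C" if "m \<le> n" for m n
      using that by (induction rule: dec_induct) (auto simp: GS)
    then show "decseq (\<lambda>k. G k x \<inter> C)" by (auto simp: decseq_def)
    show "closedin (top_of_set (G 0 x \<inter> C)) (G k x \<inter> C)" for k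
      using mono[of 0 k] cG[OF that(1)] that(2)
      by (auto intro!: closed_subset closed_Int compact_imp_closed)
  qed (use that in auto)
  have ne: "G k x \<noteq> {}" if "x \<in> space M" "F x \<noteq> {}" for k x
  proof (induction k)
    case (Suc k)
    with min[OF that(1) closed_UNIV, of k] show ?case by (auto simp: GS)
  qed (use that in \<open>simp add: G0\<close>)
  \<comment> \<open>Two points in all stages have the same distance to every \<open>d k\<close>; a
    \<open>d k\<close> close enough to one of them contradicts the triangle inequality.\<close>
  have unique: "z = w" if "\<And>k. z \<in> G k x" "\<And>k. w \<in> G k x" for z w x
  proof (rule ccontr)
    assume "z \<noteq> w"
    then obtain k where k: "dist (d k) z < dist z w / 2" using d[of "dist z w / 2" z] by auto
    have "dist z (d k) = dist w (d k)"
      using that(1,2)[of "Suc k"] by (simp add: GS) (meson order.antisym)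
    with k dist_triangle[of z w "d k"] show False by (simp add: dist_commute)
  qed
  define s where "s x = (if F x = {} then undefined else SOME z. \<forall>k. z \<in> G k x)" for x
  have s: "s x \<in> G k x" if "x \<in> space M" "F x \<noteq> {}" for x k
  proof -
    have "\<exists>z. \<forall>k. z \<in> G k x" using nest[OF that(1) closed_UNIV] ne[OF that] by auto
    then have "\<forall>k. (SOME z. \<forall>k. z \<in> G k x) \<in> G k x" by (rule someI_ex)
    then show ?thesis using that by (simp add: s_def)
  qed
  have closed_vimage: "{x \<in> space M. s x \<in> C} \<in> sets M" if C: "closed C" for C
  proof -
    \<comment> \<open>By \<open>nest\<close> and \<open>unique\<close>, the selected point lies in
      \<open>C\<close> as soon as every stage meets \<open>C\<close>. Where \<open>F x\<close> is
      empty, \<open>s\<close> is the constant \<open>undefined\<close>. Writing nonemptiness as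
      \<open>F x \<inter> UNIV \<noteq> {}\<close> makes it an instance of
      \<open>hit\<close>.\<close>
    have "s x \<in> C \<longleftrightarrow> (if F x \<inter> UNIV \<noteq> {} then \<forall>k. G k x \<inter> C \<noteq> {} else undefined \<in> C)"
      if x: "x \<in> space M" for x
    proof (cases "F x = {}")
      case False
      have "s x \<in> C" if "\<forall>k. G k x \<inter> C \<noteq> {}"
      proof -
        from nest[OF x C] that obtain z where "z \<in> C" "\<And>k. z \<in> G k x" by blast
        with unique[of z x "s x"] s[OF x False] show ?thesis by auto
      qed
      with False s[OF x False] show ?thesis by auto
    qed (simp add: s_def)
    then have "{x \<in> space M. s x \<in> C} =
        {x \<in> space M. if F x \<inter> UNIV \<noteq> {} then \<forall>k. G k x \<inter> C \<noteq> {} else undefined \<in> C}" by (intro Collect_cong conj_cong refl)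
    also have "\<dots> \<in> sets M"
      unfolding if_bool_eq_conj by (intro sets.sets_Collect hit hG C closed_UNIV)
    finally show ?thesis .
  qed
  have "s \<in> borel_measurable M"
  proof (rule borel_measurableI)
    fix S :: "'z set" assume "open S"
    then have "{x \<in> space M. s x \<in> - S} \<in> sets M" by (intro closed_vimage) auto
    moreover have "s -` S \<inter> space M = space M - {x \<in> space M. s x \<in> - S}" by auto
    ultimately show "s -` S \<inter> space M \<in> sets M" by auto
  qed
  then show thesis using that s[of _ 0] by (auto simp: G0)
qed

text \<open>The selection is taken from the first nonempty \<open>F m x\<close>, whose index depends
  measurably on \<open>x\<close>; \<open>e\<close> is the fallback where there is none.\<close>

lemma measurable_selection_sigma_compact:
  fixes F :: "nat \<Rightarrow> 'x \<Rightarrow> 'z::{metric_space, second_countable_topology} set"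
  assumes compact: "\<And>m x. x \<in> space M \<Longrightarrow> compact (F m x)"
    and hit: "\<And>m C. closed C \<Longrightarrow> {x \<in> space M. F m x \<inter> C \<noteq> {}} \<in> sets M"
    and e[measurable]: "e \<in> borel_measurable M"
  shows "\<exists>s\<in>borel_measurable M.
    \<forall>x\<in>space M. (\<exists>m. s x \<in> F m x) \<or> (\<forall>m. F m x = {}) \<and> s x = e x"
proof -
  have "\<exists>s. s \<in> borel_measurable M \<and> (\<forall>x\<in>space M. F m x \<noteq> {} \<longrightarrow> s x \<in> F m x)" for m
    by (rule measurable_selection_compact[of M "F m"]) (use compact hit in auto)
  then obtain t where [measurable]: "\<And>m. t m \<in> borel_measurable M"
    and t: "\<And>m x. x \<in> space M \<Longrightarrow> F m x \<noteq> {} \<Longrightarrow> t m x \<in> F m x" by metis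
  have [measurable]: "Measurable.pred M (\<lambda>x. F m x \<noteq> {})" for m
    using hit[OF closed_UNIV, of m] by (simp add: pred_def)
  define s where "s x = (if \<exists>m. F m x \<noteq> {} then t (LEAST m. F m x \<noteq> {}) x else e x)" for x
  have "s \<in> borel_measurable M" unfolding s_def by measurable
  moreover have "(\<exists>m. s x \<in> F m x) \<or> (\<forall>m. F m x = {}) \<and> s x = e x" if "x \<in> space M" for x
    using t[OF that] LeastI_ex[of "\<lambda>m. F m x \<noteq> {}"] by (auto simp: s_def)
  ultimately show ?thesis by blast
qed

section \<open>Topology of the spaces of datasets\<close>

text \<open>Tychonoff's theorem, with the singleton \<open>{undefined}\<close> as factor outside
  \<open>J\<close>, which is how extensional functions sit in the full function space.\<close>

lemma compact_PiE:
  fixes K :: "'i \<Rightarrow> 'a::t1_space set"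
  assumes "\<And>j. j \<in> J \<Longrightarrow> compact (K j)"
  shows "compact (PiE J K)"
proof -
  let ?K = "\<lambda>j. if j \<in> J then K j else {undefined}"
  have "compactin (product_topology (\<lambda>_. euclidean) UNIV) (PiE UNIV ?K)"
    using assms by (auto simp: compactin_PiE)
  moreover have "PiE UNIV ?K = PiE J K"
    by (auto simp: PiE_def Pi_def extensional_def split: if_splits)
  ultimately show ?thesis by (simp add: euclidean_product_topology)
qed

lemma PiE_sigma_compact:
  fixes \<X> :: "nat \<Rightarrow> 'a::euclidean_space set"
  assumes "finite J" "\<And>j. j \<in> J \<Longrightarrow> fsigma (\<X> j)"
  shows "\<exists>K :: nat \<Rightarrow> (nat \<Rightarrow> 'a) set. (\<forall>m. compact (K m)) \<and> PiE J \<X> = (\<Union>m. K m)"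
proof -
  have "\<exists>F :: nat \<Rightarrow> 'a set. \<forall>m. compact (F m) \<and> \<X> j = (\<Union>m. F m)" if j: "j \<in> J" for j
  proof -
    obtain F :: "nat \<Rightarrow> 'a set" where "range F \<subseteq> Collect compact" "\<X> j = \<Union>(range F)"
      using assms(2)[OF j] unfolding fsigma_Union_compact by blast
    then show ?thesis by (intro exI[of _ F]) auto
  qed
  then have "\<forall>j\<in>J. \<exists>F :: nat \<Rightarrow> 'a set. \<forall>m. compact (F m) \<and> \<X> j = (\<Union>m. F m)" by blast
  from bchoice[OF this] obtain F :: "nat \<Rightarrow> nat \<Rightarrow> 'a set"
    where F': "\<forall>j\<in>J. \<forall>m. compact (F j m) \<and> \<X> j = (\<Union>m. F j m)" ..
  then have F: "\<And>j m. j \<in> J \<Longrightarrow> compact (F j m)" "\<And>j. j \<in> J \<Longrightarrow> \<X> j = (\<Union>m. F j m)"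
    by simp_all
  \<comment> \<open>Taking unions over \<open>l \<le> m\<close> makes the factors increase with
    \<open>m\<close>, so that the maximum of the finitely many indices needed by the coordinates of
    a point works for all of them.\<close>
  define K where "K m = PiE J (\<lambda>j. \<Union>l\<le>m. F j l)" for m :: nat
  show ?thesis
  proof (intro exI conjI allI)
    show "compact (K m)" for m
      unfolding K_def by (intro compact_PiE compact_UN) (use F(1) in auto)
    show "PiE J \<X> = (\<Union>m. K m)"
    proof (intro equalityI subsetI)
      fix w assume w: "w \<in> PiE J \<X>"
      have "\<forall>j\<in>J. \<exists>l. w j \<in> F j l"
      proof
        fix j assume "j \<in> J"
        then show "\<exists>l. w j \<in> F j l" using F(2)[of j] PiE_mem[OF w, of j] by simp
      qed
      from bchoice[OF this] obtain l where l: "\<forall>j\<in>J. w j \<in> F j (l j)" ..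
      have "l j \<le> Max (l ` J)" if "j \<in> J" for j using assms(1) that by auto
      then have "\<exists>k\<le>Max (l ` J). w j \<in> F j k" if "j \<in> J" for j using l that by blast
      then have "w \<in> K (Max (l ` J))" using w by (simp add: K_def PiE_iff Bex_def)
      then show "w \<in> (\<Union>m. K m)" by (rule UN_I[OF UNIV_I])
    next
      fix w assume "w \<in> (\<Union>m. K m)"
      then show "w \<in> PiE J \<X>" using F(2) by (force simp: K_def PiE_iff)
    qed
  qed
qed

section \<open>Measurable structure of records and datasets\<close>

lemma space_record_space [simp]: "space (record_space \<X> i) = \<X> i"
  by (simp add: record_space_def space_restrict_space)

lemma space_data_space [simp]: "space (data_space \<X> J) = PiE J \<X>"
  by (simp add: data_space_def space_PiM)

lemma space_output_space [simp]: "space (output_space \<Y>) = \<Y>"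
  by (simp add: output_space_def space_restrict_space)

lemma measurable_record_space:
  "f \<in> M \<rightarrow>\<^sub>M record_space \<X> i \<longleftrightarrow> f \<in> borel_measurable M \<and> f \<in> space M \<rightarrow> \<X> i"
  by (auto simp: record_space_def measurable_restrict_space2_iff)

lemma measurable_component_borel:
  "(\<lambda>w :: nat \<Rightarrow> 'a::second_countable_topology. w i) \<in> borel_measurable borel"
  by (intro borel_measurable_continuous_onI continuous_on_product_coordinates)

text \<open>Links the product \<sigma>-algebra with the topology of the function space, so that
  compact sets and inner regularity can be used for datasets. On \<open>nat\<close>-indexed families
  the product of Borel \<sigma>-algebras is Borel, and the coordinates outside \<open>J\<close> are
  constant.\<close>

lemma sets_data_space:
  fixes \<X> :: "nat \<Rightarrow> 'a::euclidean_space set"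
  shows "sets (data_space \<X> J) = sets (restrict_space borel (PiE J \<X>))"
proof (intro equalityI subsetI)
  let ?R = "restrict_space borel (PiE J \<X>)"
  fix A assume A: "A \<in> sets (data_space \<X> J)"
  have "(\<lambda>w. w) \<in> ?R \<rightarrow>\<^sub>M data_space \<X> J"
    unfolding data_space_def
  proof (rule measurable_PiM_single')
    fix j assume "j \<in> J"
    then show "(\<lambda>w. w j) \<in> ?R \<rightarrow>\<^sub>M record_space \<X> j"
      unfolding measurable_record_space
      by (simp add: measurable_restrict_space1 measurable_component_borel space_restrict_space PiE_mem)
  qed (simp add: space_restrict_space)
  from measurable_sets[OF this A] sets.sets_into_space[OF A]
  show "A \<in> sets ?R" by (simp add: space_restrict_space Int_absorb2)
next
  fix A assume "A \<in> sets (restrict_space borel (PiE J \<X>))"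
  then obtain B where B: "B \<in> sets borel" "A = PiE J \<X> \<inter> B" by (auto simp: sets_restrict_space)
  have "(\<lambda>w. w) \<in> data_space \<X> J \<rightarrow>\<^sub>M PiM UNIV (\<lambda>_. borel)"
  proof (rule measurable_PiM_single')
    fix j
    show "(\<lambda>w. w j) \<in> borel_measurable (data_space \<X> J)"
    proof (cases "j \<in> J")
      case True
      then have "(\<lambda>w. w j) \<in> data_space \<X> J \<rightarrow>\<^sub>M record_space \<X> j"
        unfolding data_space_def by (rule measurable_component_singleton)
      from this[unfolded measurable_record_space] show ?thesis by (rule conjunct1)
    next
      case False
      then have "w j = undefined" if "w \<in> space (data_space \<X> J)" for w
        using that by (auto simp: PiE_iff extensional_def)
      then show ?thesis by (subst measurable_cong[of _ _ "\<lambda>_. undefined"]) simp_all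
    qed
  qed simp
  then have "(\<lambda>w. w) \<in> borel_measurable (data_space \<X> J)"
    unfolding measurable_cong_sets[OF refl sets_PiM_equal_borel] .
  from measurable_sets[OF this B(1)] B(2) show "A \<in> sets (data_space \<X> J)"
    by (simp add: Int_commute)
qed

lemma measurable_data_space:
  fixes f :: "'x \<Rightarrow> nat \<Rightarrow> 'a::euclidean_space"
  shows "f \<in> M \<rightarrow>\<^sub>M data_space \<X> J \<longleftrightarrow> f \<in> borel_measurable M \<and> f \<in> space M \<rightarrow> PiE J \<X>"
proof -
  have "M \<rightarrow>\<^sub>M data_space \<X> J = M \<rightarrow>\<^sub>M restrict_space borel (PiE J \<X>)"
    by (rule measurable_cong_sets[OF refl sets_data_space])
  then show ?thesis by (simp only: measurable_restrict_space2_iff conj_commute)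
qed

lemma PiE_minus_upd:
  assumes "i \<in> I" "z \<in> PiE (I - {i}) \<X>" "x \<in> \<X> i"
  shows "z(i := x) \<in> PiE I \<X>"
  using PiE_fun_upd[OF assms(3,2)] assms(1) by (simp add: insert_absorb)

lemma measurable_upd:
  assumes "i \<in> I"
  shows "(\<lambda>(x, z). z(i := x)) \<in> record_space \<X> i \<Otimes>\<^sub>M data_space \<X> (I - {i}) \<rightarrow>\<^sub>M data_space \<X> I"
proof -
  have I: "insert i (I - {i}) = I" using assms by auto
  have "(\<lambda>(z, x). z(i := x)) \<in> data_space \<X> (I - {i}) \<Otimes>\<^sub>M record_space \<X> i \<rightarrow>\<^sub>M data_space \<X> I"
    using measurable_add_dim[of i "I - {i}" "record_space \<X>"] unfolding data_space_def I .
  from measurable_compose[OF measurable_pair_swap' this] show ?thesis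
    by (simp add: case_prod_beta')
qed

lemma continuous_on_upd [continuous_intros]:
  fixes f :: "'c::topological_space \<Rightarrow> 'i \<Rightarrow> 'a::topological_space"
  assumes "continuous_on S f"
  shows "continuous_on S (\<lambda>z. (f z)(i := x))"
proof (rule continuous_on_coordinatewise_then_product)
  show "continuous_on S (\<lambda>z. ((f z)(i := x)) j)" for j
    using continuous_on_product_then_coordinatewise[OF assms, of j] by (cases "j = i") auto
qed

section \<open>Selection channels are averaged channels\<close>

lemma is_channelD:
  assumes "is_channel M \<Y> q"
  shows "(\<lambda>(x, y). q x y) \<in> borel_measurable (M \<Otimes>\<^sub>M output_space \<Y>)"
    and "\<And>x y. x \<in> space M \<Longrightarrow> y \<in> \<Y> \<Longrightarrow> 0 \<le> q x y"
    and "\<And>x. x \<in> space M \<Longrightarrow> (\<integral>\<^sup>+ y. ennreal (q x y) \<partial>output_space \<Y>) = 1"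
  using assms unfolding is_channel_def by blast+

lemma channel_measurable_fst:
  assumes "is_channel M \<Y> q" "y \<in> \<Y>"
  shows "(\<lambda>x. q x y) \<in> borel_measurable M"
proof -
  have y: "y \<in> space (output_space \<Y>)" using assms(2) by simp
  show ?thesis using measurable_compose[OF measurable_Pair2'[OF y] is_channelD(1)[OF assms(1)]] by (simp only: prod.case)
qed

text \<open>Both quantifiers run over uncountable sets, so they are replaced by dense sequences: a
  match in \<open>K\<close> exists iff points of a dense sequence in \<open>K\<close> fit
  arbitrarily well on longer and longer initial segments of a dense sequence in \<open>\<Y>\<close>.
  Compactness of \<open>K\<close> turns the approximate fits into an exact one.\<close>

lemma measurable_hit_matching:
  fixes \<X> :: "nat \<Rightarrow> 'a::euclidean_space set" and \<Y> :: "'b::euclidean_space set"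
  assumes i: "i \<in> I" and p: "is_channel (data_space \<X> I) \<Y> p"
    and cont: "continuous_on (\<Y> \<times> PiE I \<X>) (\<lambda>(y, x). p x y)"
    and q: "is_channel (record_space \<X> i) \<Y> q" and \<Y>: "\<Y> \<noteq> {}"
    and match: "\<And>x. x \<in> \<X> i \<Longrightarrow> \<exists>z\<in>PiE (I - {i}) \<X>. \<forall>y\<in>\<Y>. q x y = p (z(i := x)) y"
    and K: "compact K" "K \<subseteq> PiE (I - {i}) \<X>"
  shows "{x \<in> \<X> i. \<exists>z\<in>K. \<forall>y\<in>\<Y>. q x y = p (z(i := x)) y} \<in> sets (record_space \<X> i)"
proof (cases "K = {}")
  case False
  obtain e :: "nat \<Rightarrow> 'b" where e: "range e \<subseteq> \<Y>" "\<And>y \<epsilon>. y \<in> \<Y> \<Longrightarrow> \<epsilon> > 0 \<Longrightarrow> \<exists>k. dist (e k) y < \<epsilon>"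
    using dense_sequence_in[OF \<Y>] by metis
  obtain d :: "nat \<Rightarrow> nat \<Rightarrow> 'a" where d: "range d \<subseteq> K" "\<And>z \<epsilon>. z \<in> K \<Longrightarrow> \<epsilon> > 0 \<Longrightarrow> \<exists>k. dist (d k) z < \<epsilon>"
    using dense_sequence_in[OF False] by metis
  have e\<Y>: "e j \<in> \<Y>" and dK: "d k \<in> K" for j k using e(1) d(1) by auto
  define g where "g N x z = (\<Sum>j\<le>N. \<bar>q x (e j) - p (z(i := x)) (e j)\<bar>)" for N :: nat and x z
  have upd: "z(i := x) \<in> PiE I \<X>" if "x \<in> \<X> i" "z \<in> K" for x z
    using PiE_minus_upd[OF i, of z \<X> x] that K(2) by blast
  have cont1: "continuous_on K (\<lambda>z. p (z(i := x)) y)" if x: "x \<in> \<X> i" and y: "y \<in> \<Y>" for x y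
  proof -
    have "continuous_on K (\<lambda>z. (y, z(i := x)))" by (intro continuous_intros)
    from continuous_on_compose2[OF cont this] show ?thesis using upd[OF x] y by auto
  qed
  have cont2: "continuous_on \<Y> (\<lambda>y. p w y)" if w: "w \<in> PiE I \<X>" for w
  proof -
    have "continuous_on \<Y> (\<lambda>y. (y, w))" by (intro continuous_intros)
    from continuous_on_compose2[OF cont this] show ?thesis using w by auto
  qed
  have contg: "continuous_on K (g N x)" if x: "x \<in> \<X> i" for N x
    unfolding g_def[abs_def] by (intro continuous_intros cont1 x e\<Y>)
  have iff: "(\<exists>z\<in>K. \<forall>y\<in>\<Y>. q x y = p (z(i := x)) y) \<longleftrightarrow> (\<forall>N. \<exists>k. g N x (d k) < 1 / Suc N)"
    if x: "x \<in> \<X> i" for x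
  proof
    assume "\<exists>z\<in>K. \<forall>y\<in>\<Y>. q x y = p (z(i := x)) y"
    then obtain z where z: "z \<in> K" "\<And>y. y \<in> \<Y> \<Longrightarrow> q x y = p (z(i := x)) y" by blast
    show "\<forall>N. \<exists>k. g N x (d k) < 1 / Suc N"
    proof
      fix N
      have "0 < 1 / real (Suc N)" by simp
      then obtain \<delta> where \<delta>: "\<delta> > 0" "\<And>z'. z' \<in> K \<Longrightarrow> dist z' z < \<delta> \<Longrightarrow> dist (g N x z') (g N x z) < 1 / Suc N"
        using contg[OF x, of N] z(1) unfolding continuous_on_iff by metis
      obtain k where "dist (d k) z < \<delta>" using d(2)[OF z(1) \<delta>(1)] by blast
      from \<delta>(2)[OF dK this] have "dist (g N x (d k)) (g N x z) < 1 / Suc N" .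
      moreover have "g N x z = 0" using z(2)[OF e\<Y>] by (simp add: g_def)
      ultimately show "\<exists>k. g N x (d k) < 1 / Suc N"
        by (intro exI[of _ k]) (simp add: dist_real_def)
    qed
  next
    assume "\<forall>N. \<exists>k. g N x (d k) < 1 / Suc N"
    then obtain k where k: "\<And>N. g N x (d (k N)) < 1 / Suc N" by metis
    \<comment> \<open>A limit point \<open>l\<close> of the approximate matches is the candidate for
      the exact match.\<close>
    obtain l r where l: "l \<in> K" "strict_mono r" "((\<lambda>N. d (k N)) \<circ> r) \<longlonglongrightarrow> l"
      using K(1) dK unfolding compact_eq_seq_compact_metric seq_compact_def by metis
    have eq: "q x (e j) = p (l(i := x)) (e j)" for j
    proof -
      let ?h = "\<lambda>z. \<bar>q x (e j) - p (z(i := x)) (e j)\<bar>"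
      have "continuous_on K ?h" by (intro continuous_intros cont1 x e\<Y>)
      from continuous_on_tendsto_compose[OF this l(3) l(1)]
      have lim: "(\<lambda>N. ?h (d (k (r N)))) \<longlonglongrightarrow> ?h l" by (simp add: dK)
      have "?h l \<le> 0"
      \<comment> \<open>From \<open>N = j\<close> on, the deviation at \<open>e j\<close> is a
        summand of \<open>g (r N)\<close>, because \<open>r N \<ge> N\<close>.\<close>
      proof (rule LIMSEQ_le[OF lim LIMSEQ_inverse_real_of_nat], intro exI allI impI)
        fix N assume N: "j \<le> N"
        then have rN: "j \<le> r N" "N \<le> r N" using seq_suble[OF l(2), of N] by auto
        have "?h (d (k (r N))) \<le> g (r N) x (d (k (r N)))"
          unfolding g_def using rN by (intro member_le_sum) auto
        also have "\<dots> \<le> 1 / Suc (r N)" using k by (rule less_imp_le)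
        also have "\<dots> \<le> inverse (real (Suc N))" using rN by (simp add: field_simps)
        finally show "?h (d (k (r N))) \<le> inverse (real (Suc N))" .
      qed
      then show ?thesis by simp
    qed
    \<comment> \<open>A channel is only measurable in \<open>y\<close>. Here \<open>q x\<close>
      agrees on \<open>\<Y>\<close> with \<open>p\<close> at the dataset given by
      \<open>match\<close>, hence is continuous there, and its equality with
      \<open>p (l(i := x))\<close> extends from the dense sequence to \<open>\<Y>\<close>.\<close>
    obtain z where z: "z \<in> PiE (I - {i}) \<X>" "\<And>y. y \<in> \<Y> \<Longrightarrow> q x y = p (z(i := x)) y"
      using match[OF x] by blast
    have "q x y = p (l(i := x)) y" if y: "y \<in> \<Y>" for y
    proof (rule ccontr)
      let ?h = "\<lambda>y. p (z(i := x)) y - p (l(i := x)) y"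
      assume "q x y \<noteq> p (l(i := x)) y"
      with z(2)[OF y] have "0 < \<bar>?h y\<bar>" by simp
      moreover have "continuous_on \<Y> ?h"
        by (intro continuous_intros cont2 upd x l(1) PiE_minus_upd[OF i z(1)])
      ultimately obtain \<delta> where \<delta>: "\<delta> > 0" "\<And>y'. y' \<in> \<Y> \<Longrightarrow> dist y' y < \<delta> \<Longrightarrow> dist (?h y') (?h y) < \<bar>?h y\<bar>"
        using y unfolding continuous_on_iff by metis
      obtain j where "dist (e j) y < \<delta>" using e(2)[OF y \<delta>(1)] by blast
      from \<delta>(2)[OF e\<Y> this] eq[of j] z(2)[OF e\<Y>, of j] show False by (simp add: dist_real_def)
    qed
    with l(1) show "\<exists>z\<in>K. \<forall>y\<in>\<Y>. q x y = p (z(i := x)) y" by blast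
  qed
  have mq: "(\<lambda>x. q x (e j)) \<in> borel_measurable (record_space \<X> i)" for j
    by (rule channel_measurable_fst[OF q e\<Y>])
  have mp: "(\<lambda>x. p ((d k)(i := x)) (e j)) \<in> borel_measurable (record_space \<X> i)" for j k
  proof -
    have "d k \<in> space (data_space \<X> (I - {i}))" using dK K(2) by auto
    from measurable_compose[OF measurable_Pair2'[OF this] measurable_upd[OF i]]
    have "(\<lambda>x. (d k)(i := x)) \<in> record_space \<X> i \<rightarrow>\<^sub>M data_space \<X> I"
      by (simp only: prod.case)
    from measurable_compose[OF this channel_measurable_fst[OF p e\<Y>]] show ?thesis .
  qed
  have mg: "(\<lambda>x. g N x (d k)) \<in> borel_measurable (record_space \<X> i)" for N k
    unfolding g_def by (intro borel_measurable_sum borel_measurable_abs borel_measurable_diff mq mp)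
  have "{x \<in> space (record_space \<X> i). \<forall>N. \<exists>k. g N x (d k) < 1 / Suc N} \<in> sets (record_space \<X> i)"
    by (intro sets.sets_Collect_countable_All sets.sets_Collect_countable_Ex
        borel_measurable_less mg borel_measurable_const)
  also have "{x \<in> space (record_space \<X> i). \<forall>N. \<exists>k. g N x (d k) < 1 / Suc N} =
      {x \<in> \<X> i. \<exists>z\<in>K. \<forall>y\<in>\<Y>. q x y = p (z(i := x)) y}"
    by (intro Collect_cong conj_cong) (simp_all only: space_record_space iff)
  finally show ?thesis .
qed simp

lemma selection_subset_averaged:
  fixes \<X> :: "nat \<Rightarrow> 'a::euclidean_space set" and \<Y> :: "'b::euclidean_space set"
  assumes i: "i \<in> {1..n}" and \<X>: "\<And>j. j \<in> {1..n} \<Longrightarrow> \<X> j \<noteq> {} \<and> fsigma (\<X> j)"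
    and p: "is_channel (data_space \<X> {1..n}) \<Y> p"
    and cont: "continuous_on (\<Y> \<times> PiE {1..n} \<X>) (\<lambda>(y, x). p x y)"
  shows "selection_channels n \<X> \<Y> p i \<subseteq> averaged_channels n \<X> \<Y> p i"
proof
  let ?R = "record_space \<X> i" and ?J = "{1..n} - {i}"
  let ?D = "data_space \<X> {1..n}" and ?B = "data_space \<X> ?J"
  fix q assume "q \<in> selection_channels n \<X> \<Y> p i"
  then have q: "is_channel ?R \<Y> q"
    and match: "\<And>x. x \<in> \<X> i \<Longrightarrow> \<exists>z\<in>PiE ?J \<X>. \<forall>y\<in>\<Y>. q x y = p (z(i := x)) y"
    by (auto simp: selection_channels_def)
  obtain x0 where x0: "x0 \<in> \<X> i" using \<X>[OF i] by blast
  \<comment> \<open>A density of total mass 1 needs a nonempty output set.\<close>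
  have \<Y>: "\<Y> \<noteq> {}"
  proof
    assume "\<Y> = {}"
    then have "(\<integral>\<^sup>+ y. ennreal (q x0 y) \<partial>output_space \<Y>) = 0" by (intro nn_integral_empty) simp
    moreover have "(\<integral>\<^sup>+ y. ennreal (q x0 y) \<partial>output_space \<Y>) = 1"
      using is_channelD(3)[OF q] x0 unfolding space_record_space .
    ultimately show False by (metis zero_neq_one)
  qed
  have "\<exists>K. (\<forall>m. compact (K m)) \<and> PiE ?J \<X> = (\<Union>m::nat. K m)"
    by (rule PiE_sigma_compact) (use \<X> in auto)
  then obtain K :: "nat \<Rightarrow> (nat \<Rightarrow> 'a) set"
    where K: "\<And>m. compact (K m)" "PiE ?J \<X> = (\<Union>m. K m)" by blast
  have up: "z(i := x) \<in> PiE {1..n} \<X>" if "x \<in> \<X> i" "z \<in> PiE ?J \<X>" for x z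
    by (rule PiE_minus_upd[OF i that(2,1)])
  obtain z0 where z0: "z0 \<in> PiE ?J \<X>" using match[OF x0] by blast
  define F where "F m x = {z \<in> K m. \<forall>y\<in>\<Y>. q x y = p (z(i := x)) y}" for m x
  have cF: "compact (F m x)" if x: "x \<in> \<X> i" for m x
  proof -
    have c: "continuous_on (K m) (\<lambda>z. p (z(i := x)) y)" if y: "y \<in> \<Y>" for y
    proof -
      have "continuous_on (K m) (\<lambda>z. (y, z(i := x)))" by (intro continuous_intros)
      from continuous_on_compose2[OF cont this] show ?thesis
        using up[OF x] K(2) y by auto
    qed
    have "closed {z \<in> K m. q x y = p (z(i := x)) y}" if "y \<in> \<Y>" for y
      using continuous_closed_preimage_constant[OF c[OF that] compact_imp_closed[OF K(1)], of "q x y"]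
      by (simp add: eq_commute)
    then have "compact (K m \<inter> (\<Inter>y\<in>\<Y>. {z \<in> K m. q x y = p (z(i := x)) y}))"
      by (intro compact_Int_closed K closed_INT) auto
    also have "K m \<inter> (\<Inter>y\<in>\<Y>. {z \<in> K m. q x y = p (z(i := x)) y}) = F m x"
      by (auto simp: F_def)
    finally show ?thesis .
  qed
  \<comment> \<open>Intersecting with \<open>C\<close> only shrinks the compact set in which a match
    is sought, so the preceding measurability result applies to
    \<open>K m \<inter> C\<close>.\<close>
  have hF: "{x \<in> \<X> i. F m x \<inter> C \<noteq> {}} \<in> sets ?R" if "closed C" for m C
  proof -
    have "{x \<in> \<X> i. F m x \<inter> C \<noteq> {}} = {x \<in> \<X> i. \<exists>z\<in>K m \<inter> C. \<forall>y\<in>\<Y>. q x y = p (z(i := x)) y}"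
      unfolding F_def by blast
    also have "\<dots> \<in> sets ?R"
      by (rule measurable_hit_matching[OF i p cont q \<Y> match]) (use K that in \<open>auto simp: compact_Int_closed\<close>)
    finally show ?thesis .
  qed
  have "\<exists>s\<in>borel_measurable ?R.
      \<forall>x\<in>space ?R. (\<exists>m. s x \<in> F m x) \<or> (\<forall>m. F m x = {}) \<and> s x = z0"
    by (rule measurable_selection_sigma_compact) (use cF hF in simp_all)
  then obtain s where s: "s \<in> borel_measurable ?R"
    "\<forall>x\<in>space ?R. (\<exists>m. s x \<in> F m x) \<or> (\<forall>m. F m x = {}) \<and> s x = z0" by blast
  \<comment> \<open>Every \<open>x\<close> has a match and the sets \<open>K m\<close> exhaust the
    partial datasets, so the fallback value \<open>z0\<close> is never taken.\<close>
  have sF: "\<exists>m. s x \<in> F m x" if x: "x \<in> \<X> i" for x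
  proof -
    obtain z where z: "z \<in> PiE ?J \<X>" "\<And>y. y \<in> \<Y> \<Longrightarrow> q x y = p (z(i := x)) y"
      using match[OF x] by blast
    from z(1) obtain m where "z \<in> K m" unfolding K(2) by blast
    with z(2) have "z \<in> F m x" by (simp add: F_def)
    moreover have "x \<in> space ?R" using x by simp
    ultimately show ?thesis using s(2) by blast
  qed
  have sJ: "s x \<in> PiE ?J \<X>" and sq: "\<And>y. y \<in> \<Y> \<Longrightarrow> q x y = p ((s x)(i := x)) y" if "x \<in> \<X> i" for x
  proof -
    from sF[OF that] obtain m where "s x \<in> F m x" ..
    then show "s x \<in> PiE ?J \<X>" and "\<And>y. y \<in> \<Y> \<Longrightarrow> q x y = p ((s x)(i := x)) y"
      unfolding K(2) by (auto simp: F_def)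
  qed
  have sB: "s \<in> ?R \<rightarrow>\<^sub>M ?B"
    by (rule measurable_data_space[THEN iffD2]) (use s(1) sJ in \<open>simp add: Pi_iff\<close>)
  define \<kappa> where "\<kappa> x = return ?B (s x)" for x
  have \<kappa>: "\<kappa> \<in> ?R \<rightarrow>\<^sub>M prob_algebra ?B"
    unfolding \<kappa>_def[abs_def] by (rule measurable_compose[OF sB measurable_return_prob_space])
  have avg: "averages_to \<X> \<Y> p i \<kappa> q"
    unfolding averages_to_def
  proof (intro conjI q ballI)
    fix x y assume x: "x \<in> \<X> i" and y: "y \<in> \<Y>"
    then have "x \<in> space ?R" by simp
    from measurable_compose[OF measurable_Pair1'[OF this] measurable_upd[OF i]]
    have "(\<lambda>z. z(i := x)) \<in> ?B \<rightarrow>\<^sub>M ?D" by (simp only: prod.case)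
    from measurable_compose[OF this channel_measurable_fst[OF p y]]
    have "(\<lambda>z. p (z(i := x)) y) \<in> borel_measurable ?B" .
    from integral_return[OF _ this, of "s x"] sJ[OF x] sq[OF x y]
    show "q x y = (\<integral>z. p (z(i := x)) y \<partial>\<kappa> x)" by (simp add: \<kappa>_def)
  qed
  \<comment> \<open>Membership in the averaged channels asks for some law of \<open>X\<close> with
    conditional distribution \<open>\<kappa>\<close>; any law of the record would do, and a point
    mass is at hand.\<close>
  have \<mu>: "return ?R x0 \<in> prob_dists ?R"
    using x0 by (simp add: prob_dists_def prob_space_return)
  show "q \<in> averaged_channels n \<X> \<Y> p i"
    using kernel_compose_prob[OF i \<mu> \<kappa>] \<mu> \<kappa> avg
    unfolding averaged_channels_def factorizes_def by blast
qed

section \<open>Mutual information and its linearization\<close>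

lemma sigma_finite_output_space:
  "\<Y> \<in> sets borel \<Longrightarrow> sigma_finite_measure (output_space \<Y>)"
  unfolding output_space_def
  by (intro sigma_finite_measure_restrict_space lborel.sigma_finite_measure_axioms) simp

text \<open>Used with two kinds of input: the record \<open>x\<close> with law \<open>\<mu>\<close>,
  and, for fixed \<open>x\<close>, the partial dataset with law \<open>\<kappa> x\<close>. In the
  second case the marginal is the averaged density at \<open>x\<close>.\<close>

locale channel_input = prob_space \<mu> for \<mu> :: "'x measure" +
  fixes \<Y> :: "'b::euclidean_space set"
  assumes \<Y>: "\<Y> \<in> sets borel"
begin

abbreviation "\<Lambda> \<equiv> output_space \<Y>"

sublocale pair: pair_sigma_finite \<mu> "output_space \<Y>"
  by (intro pair_sigma_finite.intro sigma_finite_output_space \<Y> sigma_finite_measure_axioms)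

definition marginal :: "('x \<Rightarrow> 'b \<Rightarrow> real) \<Rightarrow> 'b \<Rightarrow> real" where
  "marginal q y = (\<integral>x. q x y \<partial>\<mu>)"

section \<open>Output density and integrability of the information density\<close>

context
  fixes q assumes q: "is_channel \<mu> \<Y> q"
begin

lemma channel_measurable [measurable]: "case_prod q \<in> borel_measurable (\<mu> \<Otimes>\<^sub>M \<Lambda>)"
  by (rule is_channelD(1)[OF q])

lemma marginal_measurable [measurable]: "marginal q \<in> borel_measurable \<Lambda>"
  unfolding marginal_def[abs_def] by measurable

lemma marginal_nonneg: "y \<in> \<Y> \<Longrightarrow> 0 \<le> marginal q y"
  unfolding marginal_def using is_channelD(2)[OF q] by (intro integral_nonneg_AE AE_I2)

lemma nn_integral_channel: "(\<integral>\<^sup>+y. \<integral>\<^sup>+x. q x y \<partial>\<mu> \<partial>\<Lambda>) = 1"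
proof -
  have "(\<integral>\<^sup>+y. \<integral>\<^sup>+x. q x y \<partial>\<mu> \<partial>\<Lambda>) = (\<integral>\<^sup>+x. \<integral>\<^sup>+y. q x y \<partial>\<Lambda> \<partial>\<mu>)"
    by (rule pair.Fubini') measurable
  also have "\<dots> = (\<integral>\<^sup>+x. 1 \<partial>\<mu>)"
    by (intro nn_integral_cong) (rule is_channelD(3)[OF q])
  finally show ?thesis by (simp add: emeasure_space_1)
qed

text \<open>\<open>marginal\<close> is a Bochner integral and so is 0 where the integral diverges.
  By Fubini the total mass is 1, so this happens only on a null set of outputs.\<close>

lemma AE_nn_integral_eq_marginal: "AE y in \<Lambda>. (\<integral>\<^sup>+x. q x y \<partial>\<mu>) = ennreal (marginal q y)"
proof -
  have "AE y in \<Lambda>. (\<integral>\<^sup>+x. q x y \<partial>\<mu>) \<noteq> \<infinity>"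
    by (intro nn_integral_PInf_AE) (simp_all add: nn_integral_channel)
  then show ?thesis using AE_space
  proof eventually_elim
    case (elim y)
    then have nn: "AE x in \<mu>. 0 \<le> q x y" and y: "y \<in> \<Y>"
      using is_channelD(2)[OF q] by auto
    have "integrable \<mu> (\<lambda>x. q x y)"
      using elim(1) nn channel_measurable_fst[OF q y]
      by (intro integrableI_nonneg) (auto simp: less_top)
    from nn_integral_eq_integral[OF this nn] show ?case by (simp add: marginal_def)
  qed
qed

lemma nn_integral_marginal: "(\<integral>\<^sup>+y. marginal q y \<partial>\<Lambda>) = 1"
  using nn_integral_cong_AE[OF AE_nn_integral_eq_marginal] nn_integral_channel by simp

text \<open>A nonnegative function with integral 0 vanishes almost everywhere; Fubini then exchanges
  the two quantifiers. This is the absolute continuity of \<open>q x\<close> with respect to the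
  output law.\<close>

lemma AE_marginal_zero: "AE x in \<mu>. AE y in \<Lambda>. marginal q y = 0 \<longrightarrow> q x y = 0"
proof -
  have "AE y in \<Lambda>. AE x in \<mu>. marginal q y = 0 \<longrightarrow> q x y = 0"
    using AE_nn_integral_eq_marginal AE_space
  proof eventually_elim
    case (elim y)
    show ?case
    proof (cases "marginal q y = 0")
      case True
      with elim have "(\<integral>\<^sup>+x. q x y \<partial>\<mu>) = 0" by simp
      moreover have "y \<in> \<Y>" using elim(2) by simp
      ultimately have "AE x in \<mu>. ennreal (q x y) = 0"
        using channel_measurable_fst[OF q, of y] by (subst (asm) nn_integral_0_iff_AE) auto
      then show ?thesis using AE_space
      proof eventually_elim
        case (elim x)
        with is_channelD(2)[OF q, of x y] \<open>y \<in> \<Y>\<close> show ?case by (simp add: ennreal_eq_0_iff)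
      qed
    qed simp
  qed
  then show ?thesis by (subst pair.AE_commute) measurable
qed

lemma info_density_eq: "info_density b \<mu> q x y = q x y * log b (q x y / marginal q y)"
  by (simp add: info_density_def marginal_def)

lemma info_density_measurable [measurable]:
  "case_prod (info_density b \<mu> q) \<in> borel_measurable (\<mu> \<Otimes>\<^sub>M \<Lambda>)"
  unfolding info_density_eq[abs_def] by measurable

text \<open>From \<open>ln t \<le> t - 1\<close> with \<open>t = r / q\<close>, where
  \<open>r\<close> is the marginal, the negative part is at most \<open>r / ln b\<close>, which has
  integral \<open>1 / ln b\<close>.\<close>

lemma nn_integral_neg_info:
  assumes b: "b > 1"
  shows "(\<integral>\<^sup>+ (x, y). ennreal (- info_density b \<mu> q x y) \<partial>(\<mu> \<Otimes>\<^sub>M \<Lambda>)) < \<infinity>"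
proof -
  have lnb: "ln b > 0" using b by simp
  have "(\<integral>\<^sup>+ (x, y). ennreal (- info_density b \<mu> q x y) \<partial>(\<mu> \<Otimes>\<^sub>M \<Lambda>))
      \<le> (\<integral>\<^sup>+ (x, y). ennreal (1 / ln b) * ennreal (marginal q y) \<partial>(\<mu> \<Otimes>\<^sub>M \<Lambda>))"
  proof (intro nn_integral_mono, clarify)
    fix x y assume "(x, y) \<in> space (\<mu> \<Otimes>\<^sub>M \<Lambda>)"
    then have x: "x \<in> space \<mu>" and y: "y \<in> \<Y>" by (auto simp: space_pair_measure)
    have nn: "0 \<le> q x y" "0 \<le> marginal q y" using is_channelD(2)[OF q x y] marginal_nonneg[OF y] .
    have "- info_density b \<mu> q x y \<le> marginal q y / ln b"
    proof (cases "q x y = 0 \<or> marginal q y = 0")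
      case True then show ?thesis using nn lnb by (auto simp: info_density_eq log_def)
    next
      case False
      with nn have pos: "q x y > 0" "marginal q y > 0" by auto
      have "- ln (q x y / marginal q y) = ln (marginal q y / q x y)"
        using pos by (simp add: ln_div)
      also have "\<dots> \<le> marginal q y / q x y - 1" using pos by (intro ln_le_minus_one) simp
      finally have "q x y * - ln (q x y / marginal q y) \<le> q x y * (marginal q y / q x y - 1)"
        using pos by (intro mult_left_mono) auto
      also have "\<dots> \<le> marginal q y" using pos by (simp add: field_simps)
      finally have "q x y * - ln (q x y / marginal q y) / ln b \<le> marginal q y / ln b"
        using lnb by (intro divide_right_mono) auto
      then show ?thesis by (simp add: info_density_eq log_def)
    qed
    then show "ennreal (- info_density b \<mu> q x y) \<le> ennreal (1 / ln b) * ennreal (marginal q y)"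
      using nn lnb by (simp add: ennreal_mult'[symmetric] ennreal_leI)
  qed
  also have "\<dots> = (\<integral>\<^sup>+x. \<integral>\<^sup>+y. ennreal (1 / ln b) * ennreal (marginal q y) \<partial>\<Lambda> \<partial>\<mu>)"
    by (subst pair.M2.nn_integral_fst[symmetric]) simp_all
  also have "\<dots> = ennreal (1 / ln b)"
    by (simp add: nn_integral_cmult nn_integral_marginal emeasure_space_1)
  finally show ?thesis using le_less_trans by fastforce
qed

lemma mutual_info_eq_integral:
  assumes "integrable (\<mu> \<Otimes>\<^sub>M \<Lambda>) (case_prod (info_density b \<mu> q))"
  shows "mutual_info b \<Y> \<mu> q = ereal (\<integral>(x, y). info_density b \<mu> q x y \<partial>(\<mu> \<Otimes>\<^sub>M \<Lambda>))"
proof -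
  let ?P = "\<integral>\<^sup>+ (x, y). ennreal (info_density b \<mu> q x y) \<partial>(\<mu> \<Otimes>\<^sub>M \<Lambda>)"
  let ?N = "\<integral>\<^sup>+ (x, y). ennreal (- info_density b \<mu> q x y) \<partial>(\<mu> \<Otimes>\<^sub>M \<Lambda>)"
  from assms have fin: "?P < top" "?N < top"
    unfolding real_integrable_def by (auto simp: case_prod_beta' less_top)
  have "(\<integral>(x, y). info_density b \<mu> q x y \<partial>(\<mu> \<Otimes>\<^sub>M \<Lambda>)) = enn2real ?P - enn2real ?N"
    using real_lebesgue_integral_def[OF assms] by (simp add: case_prod_beta')
  then show ?thesis
    using fin by (cases ?P; cases ?N) (simp_all add: mutual_info_def)
qed

lemma info_density_integrable:
  assumes "b > 1" "mutual_info b \<Y> \<mu> q \<noteq> \<infinity>"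
  shows "integrable (\<mu> \<Otimes>\<^sub>M \<Lambda>) (case_prod (info_density b \<mu> q))"
proof -
  let ?P = "\<integral>\<^sup>+ (x, y). ennreal (info_density b \<mu> q x y) \<partial>(\<mu> \<Otimes>\<^sub>M \<Lambda>)"
  have "?P \<noteq> top"
    using assms(2) nn_integral_neg_info[OF assms(1)] by (auto simp: mutual_info_def)
  with nn_integral_neg_info[OF assms(1)] show ?thesis
    unfolding real_integrable_def by (simp add: case_prod_beta')
qed

end

text \<open>The function \<open>(q', r') \<mapsto> q' * log b (q' / r')\<close> is convex and
  homogeneous of degree 1; the left side is its tangent plane at \<open>(q, r)\<close>. The three
  implications between zeros exclude the points where the conventions for division by 0 and the
  logarithm of 0 would break the inequality.\<close>

lemma info_pointwise_linearization:
  fixes q q' r r' :: real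
  assumes b: "b > 1" and nn: "0 \<le> q" "0 \<le> q'" "0 \<le> r" "0 \<le> r'"
    and z: "q = 0 \<Longrightarrow> q' = 0" "r = 0 \<Longrightarrow> q = 0" "r' = 0 \<Longrightarrow> q' = 0"
  shows "q' * log b (q / r) + (q' - r' * q / r) / ln b \<le> q' * log b (q' / r')"
proof (cases "q' = 0")
  case True
  then show ?thesis using b nn by simp
next
  case False
  with z nn have pos: "q' > 0" "q > 0" "r > 0" "r' > 0" by force+
  have "q' * ln (q / r) + (q' - r' * q / r) = q' * (ln (q / r) + (1 - r' * q / (r * q')))"
    using pos by (simp add: field_simps)
  also have "\<dots> \<le> q' * ln (q' / r')"
  proof (rule mult_left_mono)
    have "ln (r' * q / (r * q')) \<le> r' * q / (r * q') - 1"
      using pos by (intro ln_le_minus_one) simp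
    then show "ln (q / r) + (1 - r' * q / (r * q')) \<le> ln (q' / r')"
      using pos by (simp add: ln_div ln_mult)
  qed (use pos in simp)
  finally have "(q' * ln (q / r) + (q' - r' * q / r)) / ln b \<le> q' * ln (q' / r') / ln b"
    using b by (intro divide_right_mono) auto
  then show ?thesis by (simp add: log_def add_divide_distrib)
qed

text \<open>The tangent inequality is integrated over \<open>y\<close> and then over
  \<open>x\<close>. Its main term is compared by \<open>ge\<close>, and its correction term has
  nonnegative integral. Absolute continuity \<open>ac\<close> avoids points where the slope of the
  tangent would be infinite.\<close>

lemma mutual_info_le_by_linearization:
  assumes b: "b > 1" and q: "is_channel \<mu> \<Y> q" and q': "is_channel \<mu> \<Y> q'"
    and int: "integrable (\<mu> \<Otimes>\<^sub>M \<Lambda>) (case_prod (info_density b \<mu> q))"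
    and ac: "AE x in \<mu>. AE y in \<Lambda>. q x y = 0 \<longrightarrow> q' x y = 0"
    and lin: "AE x in \<mu>. integrable \<Lambda> (\<lambda>y. q' x y * log b (q x y / marginal q y))"
    and ge: "AE x in \<mu>. (\<integral>y. info_density b \<mu> q x y \<partial>\<Lambda>)
                        \<le> (\<integral>y. q' x y * log b (q x y / marginal q y) \<partial>\<Lambda>)"
  shows "mutual_info b \<Y> \<mu> q \<le> mutual_info b \<Y> \<mu> q'"
proof (cases "mutual_info b \<Y> \<mu> q' = \<infinity>")
  case False
  note [measurable] = channel_measurable[OF q] channel_measurable[OF q']
    marginal_measurable[OF q] marginal_measurable[OF q']
  have lnb: "ln b > 0" using b by simp
  note int' = info_density_integrable[OF q' b False]
  \<comment> \<open>The term \<open>r' q / r\<close> of the tangent plane, with \<open>r\<close> and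
    \<open>r'\<close> the two marginals. For almost every \<open>y\<close> its integral over
    \<open>x\<close> is \<open>r' y\<close> if \<open>r y > 0\<close>, and 0 if
    \<open>r y = 0\<close> since division by 0 yields 0. Hence its total mass is at most 1, not
    always equal to 1.\<close>
  define E where "E x y = marginal q' y * q x y / marginal q y" for x y
  have [measurable]: "case_prod E \<in> borel_measurable (\<mu> \<Otimes>\<^sub>M \<Lambda>)"
    unfolding E_def[abs_def] by measurable
  have Enn: "0 \<le> E x y" if "x \<in> space \<mu>" "y \<in> \<Y>" for x y
    unfolding E_def using is_channelD(2)[OF q that] marginal_nonneg[OF q that(2)]
      marginal_nonneg[OF q' that(2)] by simp
  have "(\<integral>\<^sup>+ w. ennreal (case_prod E w) \<partial>(\<mu> \<Otimes>\<^sub>M \<Lambda>)) = (\<integral>\<^sup>+y. \<integral>\<^sup>+x. ennreal (E x y) \<partial>\<mu> \<partial>\<Lambda>)"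
    by (subst pair.nn_integral_snd[symmetric]) simp_all
  also have "\<dots> \<le> (\<integral>\<^sup>+y. ennreal (marginal q' y) \<partial>\<Lambda>)"
  proof (rule nn_integral_mono_AE)
    show "AE y in \<Lambda>. (\<integral>\<^sup>+x. ennreal (E x y) \<partial>\<mu>) \<le> ennreal (marginal q' y)"
      using AE_nn_integral_eq_marginal[OF q] AE_space
    proof eventually_elim
      case (elim y)
      then have y: "y \<in> \<Y>" by simp
      note nn = marginal_nonneg[OF q y] marginal_nonneg[OF q' y]
      note [measurable] = channel_measurable_fst[OF q y]
      have "(\<integral>\<^sup>+x. ennreal (E x y) \<partial>\<mu>) = (\<integral>\<^sup>+x. ennreal (marginal q' y / marginal q y) * ennreal (q x y) \<partial>\<mu>)"
        using nn by (intro nn_integral_cong) (simp add: E_def flip: ennreal_mult')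
      also have "\<dots> = ennreal (marginal q' y / marginal q y) * ennreal (marginal q y)"
        by (subst nn_integral_cmult) (simp_all add: elim(1))
      also have "\<dots> \<le> ennreal (marginal q' y)"
        using nn by (cases "marginal q y = 0") (simp_all flip: ennreal_mult')
      finally show ?case .
    qed
  qed
  also have "\<dots> = 1" by (rule nn_integral_marginal[OF q'])
  finally have E1: "(\<integral>\<^sup>+ w. ennreal (case_prod E w) \<partial>(\<mu> \<Otimes>\<^sub>M \<Lambda>)) \<le> 1" .
  have Enn': "AE w in \<mu> \<Otimes>\<^sub>M \<Lambda>. 0 \<le> case_prod E w"
    using Enn by (intro AE_I2) (auto simp: space_pair_measure)
  have intE: "integrable (\<mu> \<Otimes>\<^sub>M \<Lambda>) (case_prod E)"
    using E1 Enn' by (intro integrableI_nonneg) (auto intro: le_less_trans)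
  have E1': "(\<integral>w. case_prod E w \<partial>(\<mu> \<Otimes>\<^sub>M \<Lambda>)) \<le> 1"
    using E1 nn_integral_eq_integral[OF intE Enn'] by simp
  have "AE x in \<mu>. (\<integral>y. info_density b \<mu> q x y \<partial>\<Lambda>) + (1 - (\<integral>y. E x y \<partial>\<Lambda>)) / ln b
                     \<le> (\<integral>y. info_density b \<mu> q' x y \<partial>\<Lambda>)"
    using ac lin ge AE_marginal_zero[OF q] AE_marginal_zero[OF q'] AE_space
      pair.AE_integrable_fst'[OF int'] pair.AE_integrable_fst'[OF intE]
  proof eventually_elim
    case (elim x)
    have q'1: "integrable \<Lambda> (\<lambda>y. q' x y)" "(\<integral>y. q' x y \<partial>\<Lambda>) = 1"
    proof -
      have m: "(\<lambda>y. q' x y) \<in> borel_measurable \<Lambda>"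
        by (rule measurable_Pair_compose_split[OF channel_measurable[OF q']]) (use elim in simp_all)
      have nn: "AE y in \<Lambda>. 0 \<le> q' x y" using is_channelD(2)[OF q' elim(6)] by (intro AE_I2) simp
      show "integrable \<Lambda> (\<lambda>y. q' x y)"
        using m nn is_channelD(3)[OF q' elim(6)] by (intro integrableI_nonneg) simp_all
      show "(\<integral>y. q' x y \<partial>\<Lambda>) = 1"
        using integral_eq_nn_integral[OF m nn] is_channelD(3)[OF q' elim(6)] by simp
    qed
    have iE: "integrable \<Lambda> (E x)" and i': "integrable \<Lambda> (info_density b \<mu> q' x)"
      using elim(7,8) by simp_all
    have "(\<integral>y. q' x y * log b (q x y / marginal q y) \<partial>\<Lambda>) + (1 - (\<integral>y. E x y \<partial>\<Lambda>)) / ln b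
        = (\<integral>y. q' x y * log b (q x y / marginal q y) + (q' x y - E x y) / ln b \<partial>\<Lambda>)"
      using elim(2) q'1 iE by simp
    also have "\<dots> \<le> (\<integral>y. info_density b \<mu> q' x y \<partial>\<Lambda>)"
    proof (rule integral_mono_AE)
      show "AE y in \<Lambda>. q' x y * log b (q x y / marginal q y) + (q' x y - E x y) / ln b
          \<le> info_density b \<mu> q' x y"
        using elim(1,4,5) AE_space
      proof eventually_elim
        case (elim y)
        then have y: "y \<in> \<Y>" by simp
        show ?case unfolding E_def info_density_eq[OF q']
          by (rule info_pointwise_linearization[OF b])
            (use elim is_channelD(2)[OF q \<open>x \<in> space \<mu>\<close> y] is_channelD(2)[OF q' \<open>x \<in> space \<mu>\<close> y]
              marginal_nonneg[OF q y] marginal_nonneg[OF q' y] in auto)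
      qed
    qed (use elim(2) q'1 iE i' in simp_all)
    finally show ?case using elim(3) by linarith
  qed
  then have "(\<integral>x. (\<integral>y. info_density b \<mu> q x y \<partial>\<Lambda>) + (1 - (\<integral>y. E x y \<partial>\<Lambda>)) / ln b \<partial>\<mu>)
      \<le> (\<integral>x. (\<integral>y. info_density b \<mu> q' x y \<partial>\<Lambda>) \<partial>\<mu>)"
    using pair.integrable_fst'[OF int] pair.integrable_fst'[OF int'] pair.integrable_fst'[OF intE]
    by (intro integral_mono_AE) simp_all
  moreover have "(\<integral>x. (\<integral>y. info_density b \<mu> q x y \<partial>\<Lambda>) + (1 - (\<integral>y. E x y \<partial>\<Lambda>)) / ln b \<partial>\<mu>)
      = (\<integral>x. (\<integral>y. info_density b \<mu> q x y \<partial>\<Lambda>) \<partial>\<mu>) + (1 - (\<integral>x. (\<integral>y. E x y \<partial>\<Lambda>) \<partial>\<mu>)) / ln b"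
    using pair.integrable_fst'[OF int] pair.integrable_fst'[OF intE] by (simp add: prob_space)
  \<comment> \<open>For a single \<open>x\<close> the correction may be negative; only its average
    over \<open>\<mu>\<close> has a sign.\<close>
  moreover have "0 \<le> (1 - (\<integral>x. (\<integral>y. E x y \<partial>\<Lambda>) \<partial>\<mu>)) / ln b"
    using E1' pair.integral_fst'[OF intE] lnb by simp
  ultimately have "(\<integral>x. (\<integral>y. info_density b \<mu> q x y \<partial>\<Lambda>) \<partial>\<mu>)
      \<le> (\<integral>x. (\<integral>y. info_density b \<mu> q' x y \<partial>\<Lambda>) \<partial>\<mu>)" by linarith
  with pair.integral_fst'[OF int] pair.integral_fst'[OF int'] show ?thesis
    unfolding mutual_info_eq_integral[OF q int] mutual_info_eq_integral[OF q' int'] by simp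
qed simp

section \<open>Averaging a functional of the output density over the input\<close>

lemma nn_integral_mixture:
  assumes q: "is_channel \<mu> \<Y> q" and [measurable]: "V \<in> borel_measurable \<Lambda>"
  shows "(\<integral>\<^sup>+x. \<integral>\<^sup>+y. ennreal (q x y) * V y \<partial>\<Lambda> \<partial>\<mu>) = (\<integral>\<^sup>+y. ennreal (marginal q y) * V y \<partial>\<Lambda>)"
proof -
  note [measurable] = channel_measurable[OF q]
  have "(\<integral>\<^sup>+x. \<integral>\<^sup>+y. ennreal (q x y) * V y \<partial>\<Lambda> \<partial>\<mu>) = (\<integral>\<^sup>+y. \<integral>\<^sup>+x. ennreal (q x y) * V y \<partial>\<mu> \<partial>\<Lambda>)"
    by (rule pair.Fubini'[symmetric]) measurable
  also have "\<dots> = (\<integral>\<^sup>+y. ennreal (marginal q y) * V y \<partial>\<Lambda>)"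
  proof (rule nn_integral_cong_AE)
    show "AE y in \<Lambda>. (\<integral>\<^sup>+x. ennreal (q x y) * V y \<partial>\<mu>) = ennreal (marginal q y) * V y"
      using AE_nn_integral_eq_marginal[OF q] AE_space
    proof eventually_elim
      case (elim y)
      then have [measurable]: "(\<lambda>x. q x y) \<in> borel_measurable \<mu>"
        by (intro channel_measurable_fst[OF q]) simp
      show ?case by (subst nn_integral_multc) (simp_all add: elim(1))
    qed
  qed
  finally show ?thesis .
qed

lemma integral_mixture:
  assumes q: "is_channel \<mu> \<Y> q" and [measurable]: "L \<in> borel_measurable \<Lambda>"
    and fin: "(\<integral>\<^sup>+y. ennreal (marginal q y) * ennreal \<bar>L y\<bar> \<partial>\<Lambda>) < \<infinity>"
  shows "integrable \<mu> (\<lambda>x. \<integral>y. q x y * L y \<partial>\<Lambda>)"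
    and "(\<integral>x. \<integral>y. q x y * L y \<partial>\<Lambda> \<partial>\<mu>) = (\<integral>y. marginal q y * L y \<partial>\<Lambda>)"
proof -
  note [measurable] = channel_measurable[OF q]
  have "(\<integral>\<^sup>+ w. ennreal (norm (q (fst w) (snd w) * L (snd w))) \<partial>(\<mu> \<Otimes>\<^sub>M \<Lambda>))
      = (\<integral>\<^sup>+x. \<integral>\<^sup>+y. ennreal (norm (q x y * L y)) \<partial>\<Lambda> \<partial>\<mu>)"
    by (subst pair.M2.nn_integral_fst[symmetric]) simp_all
  also have "\<dots> = (\<integral>\<^sup>+x. \<integral>\<^sup>+y. ennreal (q x y) * ennreal \<bar>L y\<bar> \<partial>\<Lambda> \<partial>\<mu>)"
    using is_channelD(2)[OF q] by (intro nn_integral_cong) (simp add: abs_mult ennreal_mult')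
  also have "\<dots> < \<infinity>" using fin by (subst nn_integral_mixture[OF q]) simp_all
  finally have int: "integrable (\<mu> \<Otimes>\<^sub>M \<Lambda>) (\<lambda>(x, y). q x y * L y)"
    by (intro integrableI_bounded) (simp_all add: case_prod_beta')
  show "integrable \<mu> (\<lambda>x. \<integral>y. q x y * L y \<partial>\<Lambda>)"
    using pair.integrable_fst'[OF int] by simp
  show "(\<integral>x. \<integral>y. q x y * L y \<partial>\<Lambda> \<partial>\<mu>) = (\<integral>y. marginal q y * L y \<partial>\<Lambda>)"
    using pair.Fubini_integral[OF int] by (simp add: marginal_def)
qed

text \<open>The weight \<open>\<infinity>\<close> on the zero set of the marginal encodes absolute continuity of \<open>q x\<close> with
  respect to the marginal.\<close>

lemma exists_above_average:
  assumes q: "is_channel \<mu> \<Y> q" and L: "L \<in> borel_measurable \<Lambda>"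
    and fin: "(\<integral>\<^sup>+y. ennreal (marginal q y) * ennreal \<bar>L y\<bar> \<partial>\<Lambda>) < \<infinity>"
    and Q: "AE x in \<mu>.
      (\<integral>\<^sup>+y. ennreal (q x y) * (ennreal \<bar>L y\<bar> + (if marginal q y = 0 then \<infinity> else 0)) \<partial>\<Lambda>) < \<infinity> \<and>
      (\<integral>y. marginal q y * L y \<partial>\<Lambda>) \<le> (\<integral>y. q x y * L y \<partial>\<Lambda>) \<longrightarrow> Q x"
  shows "\<exists>x\<in>space \<mu>. Q x"
proof (rule ccontr)
  assume none: "\<not> ?thesis"
  note [measurable] = channel_measurable[OF q] marginal_measurable[OF q] L
  let ?V = "\<lambda>y. ennreal \<bar>L y\<bar> + (if marginal q y = 0 then \<infinity> else 0)"
  have "(\<integral>\<^sup>+x. \<integral>\<^sup>+y. ennreal (q x y) * ?V y \<partial>\<Lambda> \<partial>\<mu>) = (\<integral>\<^sup>+y. ennreal (marginal q y) * ?V y \<partial>\<Lambda>)"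
    by (rule nn_integral_mixture[OF q]) measurable
  \<comment> \<open>The infinite weight is multiplied by a marginal equal to 0, and
    \<open>0 * \<infinity> = 0\<close>, so the total stays finite.\<close>
  also have "\<dots> = (\<integral>\<^sup>+y. ennreal (marginal q y) * ennreal \<bar>L y\<bar> \<partial>\<Lambda>)"
    by (intro nn_integral_cong) simp
  finally have "AE x in \<mu>. (\<integral>\<^sup>+y. ennreal (q x y) * ?V y \<partial>\<Lambda>) \<noteq> \<infinity>"
    using fin by (intro nn_integral_PInf_AE) simp_all
  then have less: "AE x in \<mu>. (\<integral>y. q x y * L y \<partial>\<Lambda>) < (\<integral>y. marginal q y * L y \<partial>\<Lambda>)"
    using Q AE_space
  proof eventually_elim
    case (elim x)
    then show ?case using none by (auto simp: less_top not_le)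
  qed
  \<comment> \<open>On a probability space a function that is almost everywhere strictly below a
    constant has its mean strictly below it; but by Fubini the mean equals that constant.\<close>
  have "(\<integral>x. \<integral>y. q x y * L y \<partial>\<Lambda> \<partial>\<mu>) < (\<integral>x. \<integral>y. marginal q y * L y \<partial>\<Lambda> \<partial>\<mu>)"
    by (rule integral_less_AE_space[OF integral_mixture(1)[OF q L fin] _ less])
      (simp_all add: emeasure_space_1)
  with integral_mixture(2)[OF q L fin] show False by (simp add: prob_space)
qed

end

section \<open>Attaining the maximum\<close>

lemma is_channel_cong_sets:
  assumes "sets M = sets N"
  shows "is_channel M \<Y> q \<longleftrightarrow> is_channel N \<Y> q"
proof -
  have pair: "sets (M \<Otimes>\<^sub>M output_space \<Y>) = sets (N \<Otimes>\<^sub>M output_space \<Y>)"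
    by (intro sets_pair_measure_cong assms refl)
  show ?thesis
    unfolding is_channel_def sets_eq_imp_space_eq[OF assms] measurable_cong_sets[OF pair refl]
    by (rule refl)
qed

text \<open>The supremum in inner regularity is approached along a sequence of compact sets. Their
  union has the measure of \<open>A\<close>, and finiteness of the measure permits the
  subtraction.\<close>

lemma inner_regular_sequence:
  fixes \<nu> :: "'z::{second_countable_topology, complete_space} measure"
  assumes \<nu>: "finite_measure \<nu>" "sets \<nu> = sets borel" and A: "A \<in> sets borel"
  shows "\<exists>K. (\<forall>m::nat. compact (K m) \<and> K m \<subseteq> A) \<and> emeasure \<nu> (A - (\<Union>m. K m)) = 0"
proof -
  interpret finite_measure \<nu> by fact
  let ?C = "{K. K \<subseteq> A \<and> compact K}"
  have "?C \<noteq> {}" by auto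
  from ennreal_SUP_countable_SUP[OF this, of "emeasure \<nu>"] obtain f :: "nat \<Rightarrow> ennreal"
    where f: "range f \<subseteq> emeasure \<nu> ` ?C" "(SUP K\<in>?C. emeasure \<nu> K) = (SUP m. f m)" by metis
  have "\<forall>m. \<exists>K. K \<in> ?C \<and> f m = emeasure \<nu> K" using f(1) by blast
  from choice[OF this] obtain K where K: "\<And>m. K m \<in> ?C" "\<And>m. f m = emeasure \<nu> (K m)" by blast
  have KB: "K m \<in> sets \<nu>" for m using K(1)[of m] by (simp add: \<nu>(2) borel_compact)
  have U: "(\<Union>m. K m) \<in> sets \<nu>" "(\<Union>m. K m) \<subseteq> A" using KB K(1) by auto
  have "emeasure \<nu> A = (SUP m. emeasure \<nu> (K m))"
    using inner_regular[OF \<nu>(2) _ A] f(2) K(2) by simp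
  also have "\<dots> \<le> emeasure \<nu> (\<Union>m. K m)"
    by (intro SUP_least emeasure_mono U) auto
  finally have "emeasure \<nu> A \<le> emeasure \<nu> (\<Union>m. K m)" .
  moreover have "emeasure \<nu> (\<Union>m. K m) \<le> emeasure \<nu> A"
    using U(2) A by (intro emeasure_mono) (simp_all add: \<nu>(2))
  moreover have "emeasure \<nu> (A - (\<Union>m. K m)) = emeasure \<nu> A - emeasure \<nu> (\<Union>m. K m)"
    using U A by (intro emeasure_Diff) (simp_all add: \<nu>(2))
  ultimately have "emeasure \<nu> (A - (\<Union>m. K m)) = 0"
    by (simp add: emeasure_eq_measure)
  with K(1) show ?thesis by blast
qed

text \<open>Inner regularity is a statement about Borel measures on the whole function space, so
  \<open>P\<close> is pushed forward along the identity. The set of datasets is \<sigma>-compact,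
  hence Borel, and so are its measurable subsets.\<close>

lemma exhaust_by_compacts:
  fixes \<X> :: "nat \<Rightarrow> 'a::euclidean_space set"
  assumes J: "finite J" "\<And>j. j \<in> J \<Longrightarrow> fsigma (\<X> j)"
    and P: "P \<in> prob_dists (data_space \<X> J)" and A: "A \<in> sets (data_space \<X> J)"
  shows "\<exists>K :: nat \<Rightarrow> _. (\<forall>m. compact (K m) \<and> K m \<subseteq> A) \<and> (AE w in P. w \<in> A \<longrightarrow> w \<in> (\<Union>m. K m))"
proof -
  let ?D = "data_space \<X> J"
  interpret P: prob_space P using P by (simp add: prob_dists_def)
  have sP: "sets P = sets ?D" using P by (simp add: prob_dists_def)
  obtain C :: "nat \<Rightarrow> (nat \<Rightarrow> 'a) set" where C: "\<And>m. compact (C m)" "PiE J \<X> = (\<Union>m. C m)"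
    using PiE_sigma_compact[of J \<X>] J by blast
  have "PiE J \<X> \<in> sets borel" unfolding C(2) using C(1) by (intro sets.countable_UN) (auto intro: borel_compact)
  then have AB: "A \<in> sets borel"
    using A unfolding sets_data_space by (subst (asm) sets_restrict_space_iff) auto
  have "(\<lambda>w. w) \<in> ?D \<rightarrow>\<^sub>M ?D" by simp
  then have "(\<lambda>w. w) \<in> borel_measurable ?D" unfolding measurable_data_space by (rule conjunct1)
  then have id: "(\<lambda>w. w) \<in> borel_measurable P" unfolding measurable_cong_sets[OF sP refl] .
  have "finite_measure (distr P borel (\<lambda>w. w))" by (rule P.finite_measure_distr[OF id])
  from inner_regular_sequence[OF this sets_distr AB] obtain K :: "nat \<Rightarrow> (nat \<Rightarrow> 'a) set"
    where K: "\<forall>m. compact (K m) \<and> K m \<subseteq> A" "emeasure (distr P borel (\<lambda>w. w)) (A - (\<Union>m. K m)) = 0"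
    by blast
  have UB: "A - (\<Union>m. K m) \<in> sets borel" 
    using K(1) by (intro sets.Diff[OF AB] sets.countable_UN) (auto intro: borel_compact)
  have "A - (\<Union>m. K m) \<subseteq> space P"
    using sets.sets_into_space[OF A] sets_eq_imp_space_eq[OF sP] by auto
  then have "emeasure P (A - (\<Union>m. K m)) = 0"
    using K(2) emeasure_distr[OF id UB] by (simp add: Int_absorb2)
  moreover have "A - (\<Union>m. K m) \<in> sets P"
    using measurable_sets[OF id UB] \<open>A - (\<Union>m. K m) \<subseteq> space P\<close> by (simp add: Int_absorb2)
  ultimately have "AE w in P. w \<notin> A - (\<Union>m. K m)" by (intro AE_not_in) (simp add: null_sets_def)
  then have "AE w in P. w \<in> A \<longrightarrow> w \<in> (\<Union>m. K m)" by eventually_elim blast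
  with K(1) show ?thesis by blast
qed

text \<open>The compact sets are taken in the space of full datasets and for the joint law, not
  separately for each \<open>x\<close>: their fibres over \<open>x\<close> then depend measurably on
  \<open>x\<close>.\<close>

lemma selection_dominates_average:
  fixes \<X> :: "nat \<Rightarrow> 'a::euclidean_space set" and \<Y> :: "'b::euclidean_space set"
  assumes i: "i \<in> {1..n}" and \<X>: "\<And>j. j \<in> {1..n} \<Longrightarrow> \<X> j \<noteq> {} \<and> fsigma (\<X> j)"
    and \<Y>: "\<Y> \<in> sets borel" and b: "b > 1"
    and p: "is_channel (data_space \<X> {1..n}) \<Y> p"
    and \<mu>: "\<mu> \<in> prob_dists (record_space \<X> i)"
    and \<kappa>: "\<kappa> \<in> record_space \<X> i \<rightarrow>\<^sub>M prob_algebra (data_space \<X> ({1..n} - {i}))"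
    and avg: "averages_to \<X> \<Y> p i \<kappa> q"
    and finite_info: "mutual_info b \<Y> \<mu> q \<noteq> \<infinity>"
  shows "\<exists>q'\<in>selection_channels n \<X> \<Y> p i. mutual_info b \<Y> \<mu> q \<le> mutual_info b \<Y> \<mu> q'"
proof -
  let ?R = "record_space \<X> i" and ?J = "{1..n} - {i}"
  let ?D = "data_space \<X> {1..n}" and ?B = "data_space \<X> ?J"
  have s\<mu>: "sets \<mu> = sets ?R" using \<mu> by (simp add: prob_dists_def)
  have sp\<mu>: "space \<mu> = \<X> i" using sets_eq_imp_space_eq[OF s\<mu>] by simp
  have up: "z(i := x) \<in> PiE {1..n} \<X>" if "x \<in> \<X> i" "z \<in> PiE ?J \<X>" for x z
    by (rule PiE_minus_upd[OF i that(2,1)])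
  interpret channel_input \<mu> \<Y>
    using \<mu> \<Y> by (simp add: channel_input_def channel_input_axioms_def prob_dists_def)
  have qR: "is_channel ?R \<Y> q" and q_eq: "\<And>x y. x \<in> \<X> i \<Longrightarrow> y \<in> \<Y> \<Longrightarrow> q x y = (\<integral>z. p (z(i := x)) y \<partial>\<kappa> x)"
    using avg unfolding averages_to_def by blast+
  have q: "is_channel \<mu> \<Y> q" using qR unfolding is_channel_cong_sets[OF s\<mu>] .
  note int = info_density_integrable[OF q b finite_info]
  \<comment> \<open>Up to a constant, the derivative of the mutual information at \<open>q\<close>
    in the direction of a density at \<open>x\<close>. \<open>h w\<close> is its value on
    \<open>p w\<close>, and \<open>G x\<close> its value on the average \<open>q x\<close>.\<close>
  define L where "L x y = log b (q x y / marginal q y)" for x y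
  define V where "V x y = ennreal \<bar>L x y\<bar> + (if q x y = 0 then \<infinity> else 0)" for x y
  define N where "N w = (\<integral>\<^sup>+y. ennreal (p w y) * V (w i) y \<partial>\<Lambda>)" for w
  define h where "h w = (\<integral>y. p w y * L (w i) y \<partial>\<Lambda>)" for w
  define G where "G x = (\<integral>y. info_density b \<mu> q x y \<partial>\<Lambda>)" for x
  have GL: "G x = (\<integral>y. q x y * L x y \<partial>\<Lambda>)" for x
    by (simp add: G_def L_def info_density_eq[OF q])
  \<comment> \<open>The good datasets. Finiteness of \<open>N w\<close> contains both the
    integrability of the linear functional and, through the weight \<open>\<infinity>\<close>, that
    \<open>p w\<close> vanishes almost everywhere on the zero set of \<open>q (w i)\<close>.\<close>
  define A where "A = {w \<in> space ?D. N w < \<infinity> \<and> G (w i) \<le> h w}"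
  note [measurable] = is_channelD(1)[OF qR] is_channelD(1)[OF p] marginal_measurable[OF q]
  have [measurable]: "case_prod L \<in> borel_measurable (?R \<Otimes>\<^sub>M \<Lambda>)"
    unfolding L_def[abs_def] by measurable
  have [measurable]: "case_prod V \<in> borel_measurable (?R \<Otimes>\<^sub>M \<Lambda>)"
    unfolding V_def[abs_def] by measurable
  have wi [measurable]: "(\<lambda>w. w i) \<in> ?D \<rightarrow>\<^sub>M ?R"
    unfolding data_space_def by (rule measurable_component_singleton[OF i])
  have Nh: "N \<in> borel_measurable ?D" "h \<in> borel_measurable ?D"
    unfolding N_def[abs_def] h_def[abs_def] by measurable
  have "G \<in> borel_measurable ?R" unfolding GL[abs_def] by measurable
  note Gi = measurable_compose[OF wi this]
  have A: "A \<in> sets ?D" 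
    unfolding A_def
    by (intro sets.sets_Collect_conj borel_measurable_less borel_measurable_le Nh Gi borel_measurable_const)
  have upd2: "(\<lambda>(x, z). z(i := x)) \<in> ?R \<Otimes>\<^sub>M ?B \<rightarrow>\<^sub>M ?D" by (rule measurable_upd[OF i])
  have upd: "(\<lambda>z. z(i := x)) \<in> ?B \<rightarrow>\<^sub>M ?D" if "x \<in> \<X> i" for x
    using measurable_compose[OF measurable_Pair1' upd2, of x] that by simp
  let ?T = "\<lambda>x. distr (\<kappa> x) ?D (\<lambda>z. z(i := x))"
  let ?P = "\<mu> \<bind> ?T"
  have T: "?T \<in> \<mu> \<rightarrow>\<^sub>M subprob_algebra ?D"
    unfolding measurable_cong_sets[OF s\<mu> refl]
    by (rule measurable_prob_algebraD[OF measurable_distr_prob_space2[OF \<kappa> upd2]])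
  have P: "?P \<in> prob_dists ?D" by (rule kernel_compose_prob[OF i \<mu> \<kappa>])
  have "\<exists>K :: nat \<Rightarrow> _. (\<forall>m. compact (K m) \<and> K m \<subseteq> A) \<and> (AE w in ?P. w \<in> A \<longrightarrow> w \<in> (\<Union>m. K m))"
    by (rule exhaust_by_compacts[OF _ _ P A]) (use \<X> in auto)
  then obtain K :: "nat \<Rightarrow> (nat \<Rightarrow> 'a) set" where K: "\<And>m. compact (K m)" "\<And>m. K m \<subseteq> A"
    and aeK: "AE w in ?P. w \<in> A \<longrightarrow> w \<in> (\<Union>m. K m)" by blast
  have AD: "A \<subseteq> PiE {1..n} \<X>" by (auto simp: A_def)
  have "K m \<in> sets ?D" for m
  proof -
    have "K m = PiE {1..n} \<X> \<inter> K m" using K(2)[of m] AD by blast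
    then show ?thesis unfolding sets_data_space sets_restrict_space
      using borel_compact[OF K(1)[of m]] by blast
  qed
  then have "(\<Union>m. K m) \<in> sets ?D" by (intro sets.countable_UN) auto
  with A have pred: "Measurable.pred ?D (\<lambda>w. w \<in> A \<longrightarrow> w \<in> (\<Union>m. K m))" by measurable
  \<comment> \<open>Disintegrates the almost sure statement under the joint law along
    \<open>\<mu>\<close> and \<open>\<kappa>\<close>.\<close>
  have ae: "AE x in \<mu>. AE z in \<kappa> x. z(i := x) \<in> A \<longrightarrow> z(i := x) \<in> (\<Union>m. K m)"
    using aeK[unfolded AE_bind[OF T pred]] AE_space
  proof eventually_elim
    case (elim x)
    then have x: "x \<in> \<X> i" by (simp add: sp\<mu>)
    then have "\<kappa> x \<in> space (prob_algebra ?B)" using measurable_space[OF \<kappa>, of x] by simp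
    then have "sets (\<kappa> x) = sets ?B" by (simp add: space_prob_algebra)
    then have "(\<lambda>z. z(i := x)) \<in> \<kappa> x \<rightarrow>\<^sub>M ?D"
      using upd[OF x] measurable_cong_sets[OF _ refl] by blast
    from AE_distrD[OF this elim(1)] show ?case .
  qed
  have hit: "AE x in \<mu>. \<exists>w\<in>(\<Union>m. K m). w i = x"
    using ae pair.AE_integrable_fst'[OF int] AE_space
  proof eventually_elim
    case (elim x)
    then have x: "x \<in> \<X> i" by (simp add: sp\<mu>)
    then have \<kappa>x: "\<kappa> x \<in> space (prob_algebra ?B)" using measurable_space[OF \<kappa>, of x] by simp
    then have s\<kappa>: "sets (\<kappa> x) = sets ?B" by (simp add: space_prob_algebra)
    then have sp\<kappa>: "space (\<kappa> x) = PiE ?J \<X>" using sets_eq_imp_space_eq[of "\<kappa> x" ?B] by simp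
    interpret k: channel_input "\<kappa> x" \<Y>
      using \<kappa>x \<Y> by (simp add: channel_input_def channel_input_axioms_def space_prob_algebra)
    let ?f = "\<lambda>z y. p (z(i := x)) y"
    have f: "is_channel (\<kappa> x) \<Y> ?f"
      unfolding is_channel_cong_sets[OF s\<kappa>]
      unfolding is_channel_def
    proof (intro conjI ballI)
      note [measurable] = upd[OF x]
      show "(\<lambda>(z, y). p (z(i := x)) y) \<in> borel_measurable (?B \<Otimes>\<^sub>M \<Lambda>)" by measurable
      fix z assume "z \<in> space ?B"
      then have w: "z(i := x) \<in> space ?D" using up[OF x] by simp
      show "0 \<le> p (z(i := x)) y" if "y \<in> \<Y>" for y by (rule is_channelD(2)[OF p w that])
      show "(\<integral>\<^sup>+ y. ennreal (p (z(i := x)) y) \<partial>\<Lambda>) = 1" by (rule is_channelD(3)[OF p w])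
    qed
    \<comment> \<open>With \<open>\<kappa> x\<close> as input law, the channel from partial datasets
      to outputs has marginal \<open>q x\<close>. So \<open>G x\<close> is the average of the values
      \<open>h (z(i := x))\<close>, and some \<open>z\<close> outside any given null set reaches
      it.\<close>
    have marg: "k.marginal ?f y = q x y" if "y \<in> \<Y>" for y
      using q_eq[OF x that] by (simp add: k.marginal_def)
    have Lx: "L x \<in> borel_measurable \<Lambda>"
      by (rule measurable_Pair_compose_split[of L ?R \<Lambda>]) (use x in simp_all)
    have "(\<integral>\<^sup>+y. ennreal (k.marginal ?f y) * ennreal \<bar>L x y\<bar> \<partial>\<Lambda>)
        = (\<integral>\<^sup>+y. ennreal (norm (info_density b \<mu> q x y)) \<partial>\<Lambda>)"
      using marg is_channelD(2)[OF qR] x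
      by (intro nn_integral_cong) (simp add: info_density_eq[OF q] L_def abs_mult ennreal_mult')
    also have "\<dots> < \<infinity>" using elim(2) by (simp add: integrable_iff_bounded)
    finally have fin: "(\<integral>\<^sup>+y. ennreal (k.marginal ?f y) * ennreal \<bar>L x y\<bar> \<partial>\<Lambda>) < \<infinity>" .
    have N_eq: "N (z(i := x)) = (\<integral>\<^sup>+y. ennreal (?f z y) *
        (ennreal \<bar>L x y\<bar> + (if k.marginal ?f y = 0 then \<infinity> else 0)) \<partial>\<Lambda>)" for z
      unfolding N_def V_def using marg by (intro nn_integral_cong) simp
    have G_eq: "G x = (\<integral>y. k.marginal ?f y * L x y \<partial>\<Lambda>)"
      unfolding GL using marg by (intro Bochner_Integration.integral_cong) simp_all
    have h_eq: "h (z(i := x)) = (\<integral>y. ?f z y * L x y \<partial>\<Lambda>)" for z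
      by (simp add: h_def)
    have "\<exists>z\<in>space (\<kappa> x). z(i := x) \<in> (\<Union>m. K m)"
    proof (rule k.exists_above_average[OF f Lx fin])
      show "AE z in \<kappa> x. (\<integral>\<^sup>+y. ennreal (?f z y) *
            (ennreal \<bar>L x y\<bar> + (if k.marginal ?f y = 0 then \<infinity> else 0)) \<partial>\<Lambda>) < \<infinity> \<and>
          (\<integral>y. k.marginal ?f y * L x y \<partial>\<Lambda>) \<le> (\<integral>y. ?f z y * L x y \<partial>\<Lambda>) \<longrightarrow> z(i := x) \<in> (\<Union>m. K m)"
        using elim(1) AE_space
      proof eventually_elim
        case (elim z)
        have "z(i := x) \<in> A" if "N (z(i := x)) < \<infinity>" "G x \<le> h (z(i := x))"
          using that up[OF x, of z] elim(2) by (simp add: A_def sp\<kappa>)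
        then show ?case using elim(1) unfolding N_eq G_eq h_eq by blast
      qed
    qed
    then show ?case by (auto intro!: bexI[of _ "_(i := x)"])
  qed
  have "PiE ?J \<X> \<noteq> {}" using \<X> by (auto simp: PiE_eq_empty_iff)
  then obtain z0 where z0: "z0 \<in> PiE ?J \<X>" by blast
  define F where "F m x = {w \<in> K m. w i = x}" for m x
  \<comment> \<open>The fallback \<open>z0(i := x)\<close> is needed on the null set of
    \<open>x\<close> missed by all \<open>K m\<close>: it still has \<open>i\<close>-th record
    \<open>x\<close>, so the result is a selection channel at every \<open>x\<close>.\<close>
  have "\<exists>s\<in>borel_measurable ?R. \<forall>x\<in>space ?R. (\<exists>m. s x \<in> F m x) \<or> (\<forall>m. F m x = {}) \<and> s x = z0(i := x)"
  proof (rule measurable_selection_sigma_compact)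
    have cont: "continuous_on S (\<lambda>w :: nat \<Rightarrow> 'a. w i)" for S
      by (rule continuous_on_subset[OF continuous_on_product_coordinates subset_UNIV])
    show "compact (F m x)" for m x
    proof -
      have "compact (K m \<inter> {w \<in> K m. w i = x})"
        by (intro compact_Int_closed K(1)
            continuous_closed_preimage_constant[OF cont compact_imp_closed[OF K(1)]])
      also have "K m \<inter> {w \<in> K m. w i = x} = F m x" by (auto simp: F_def)
      finally show ?thesis .
    qed
    show "{x \<in> space ?R. F m x \<inter> C \<noteq> {}} \<in> sets ?R" if "closed C" for m C
    proof -
      \<comment> \<open>The records whose fibre meets \<open>C\<close> form the projection of a
        compact set, which is compact and therefore Borel.\<close>
      have "compact ((\<lambda>w. w i) ` (K m \<inter> C))"
        using K(1) that by (intro compact_continuous_image cont) (simp add: compact_Int_closed)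
      then have "\<X> i \<inter> (\<lambda>w. w i) ` (K m \<inter> C) \<in> sets ?R"
        unfolding record_space_def sets_restrict_space by (blast intro: borel_compact)
      also have "\<X> i \<inter> (\<lambda>w. w i) ` (K m \<inter> C) = {x \<in> space ?R. F m x \<inter> C \<noteq> {}}"
        by (auto simp: F_def)
      finally show ?thesis .
    qed
    have "z0 \<in> space ?B" using z0 by simp
    from measurable_compose[OF measurable_Pair2'[OF this] upd2]
    have "(\<lambda>x. z0(i := x)) \<in> ?R \<rightarrow>\<^sub>M ?D" by simp
    then show "(\<lambda>x. z0(i := x)) \<in> borel_measurable ?R"
      unfolding measurable_data_space by (rule conjunct1)
  qed
  then obtain s where s: "s \<in> borel_measurable ?R"
    and sF: "\<And>x. x \<in> \<X> i \<Longrightarrow> (\<exists>m. s x \<in> F m x) \<or> (\<forall>m. F m x = {}) \<and> s x = z0(i := x)"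
    unfolding space_record_space by blast
  have sD: "s x \<in> PiE {1..n} \<X>" and si: "s x i = x" if x: "x \<in> \<X> i" for x
  proof -
    from sF[OF x] have "s x \<in> PiE {1..n} \<X> \<and> s x i = x"
    proof (elim disjE exE conjE)
      fix m assume "s x \<in> F m x"
      then have "s x \<in> K m" "s x i = x" by (simp_all add: F_def)
      with K(2) AD show ?thesis by blast
    next
      assume "s x = z0(i := x)"
      with up[OF x z0] show ?thesis by simp
    qed
    then show "s x \<in> PiE {1..n} \<X>" "s x i = x" by simp_all
  qed
  have sM [measurable]: "s \<in> ?R \<rightarrow>\<^sub>M ?D"
    unfolding measurable_data_space using s sD by simp
  have sA: "AE x in \<mu>. s x \<in> A"
    using hit AE_space
  proof eventually_elim
    case (elim x)
    then obtain m where "F m x \<noteq> {}" by (auto simp: F_def)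
    with sF[of x] elim(2) obtain m where "s x \<in> F m x" by (auto simp: sp\<mu>)
    with K(2) show ?case by (auto simp: F_def)
  qed
  define q' where "q' x = p (s x)" for x
  have q'R: "is_channel ?R \<Y> q'"
    unfolding is_channel_def
  proof (intro conjI ballI)
    show "(\<lambda>(x, y). q' x y) \<in> borel_measurable (?R \<Otimes>\<^sub>M \<Lambda>)" unfolding q'_def by measurable
    fix x assume "x \<in> space ?R"
    then have w: "s x \<in> space ?D" using sD by simp
    show "0 \<le> q' x y" if "y \<in> \<Y>" for y unfolding q'_def by (rule is_channelD(2)[OF p w that])
    show "(\<integral>\<^sup>+ y. ennreal (q' x y) \<partial>\<Lambda>) = 1" unfolding q'_def by (rule is_channelD(3)[OF p w])
  qed
  then have q': "is_channel \<mu> \<Y> q'" unfolding is_channel_cong_sets[OF s\<mu>] .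
  have "\<exists>z\<in>PiE ?J \<X>. \<forall>y\<in>\<Y>. q' x y = p (z(i := x)) y" if x: "x \<in> \<X> i" for x
  proof
    \<comment> \<open>Resetting coordinate \<open>i\<close> turns the full dataset into an
      extensional partial one; putting \<open>x\<close> back recovers \<open>s x\<close>.\<close>
    show "(s x)(i := undefined) \<in> PiE ?J \<X>" using sD[OF x] by (auto simp: PiE_iff extensional_def)
    have "((s x)(i := undefined))(i := x) = s x" using si[OF x] by (simp add: fun_upd_idem)
    then show "\<forall>y\<in>\<Y>. q' x y = p (((s x)(i := undefined))(i := x)) y" by (simp add: q'_def)
  qed
  with q'R have "q' \<in> selection_channels n \<X> \<Y> p i" by (simp add: selection_channels_def)
  moreover have "mutual_info b \<Y> \<mu> q \<le> mutual_info b \<Y> \<mu> q'"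
  proof (rule mutual_info_le_by_linearization[OF b q q' int])
    have N_eq: "N (s x) = (\<integral>\<^sup>+y. ennreal (q' x y) * V x y \<partial>\<Lambda>)" if "x \<in> \<X> i" for x
      by (simp add: N_def q'_def si[OF that])
    have meas [measurable]: "q' x \<in> borel_measurable \<Lambda>" "L x \<in> borel_measurable \<Lambda>"
        "V x \<in> borel_measurable \<Lambda>" if "x \<in> \<X> i" for x
    proof -
      show "q' x \<in> borel_measurable \<Lambda>"
        by (rule measurable_Pair_compose_split[OF is_channelD(1)[OF q'R]]) (use that in simp_all)
      show "L x \<in> borel_measurable \<Lambda>" by (rule measurable_Pair_compose_split[of L ?R \<Lambda>]) (use that in simp_all)
      show "V x \<in> borel_measurable \<Lambda>" by (rule measurable_Pair_compose_split[of V ?R \<Lambda>]) (use that in simp_all)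
    qed
    show "AE x in \<mu>. AE y in \<Lambda>. q x y = 0 \<longrightarrow> q' x y = 0"
      using sA AE_space
    proof eventually_elim
      case (elim x)
      then have x: "x \<in> \<X> i" by (simp add: sp\<mu>)
      have "(\<integral>\<^sup>+y. ennreal (q' x y) * V x y \<partial>\<Lambda>) \<noteq> \<infinity>" using elim(1) N_eq[OF x] by (auto simp: A_def)
      \<comment> \<open>\<open>V x y\<close> is infinite where \<open>q x y = 0\<close>, so
        finiteness of the product forces \<open>q' x y = 0\<close> there.\<close>
      then have "AE y in \<Lambda>. ennreal (q' x y) * V x y \<noteq> \<infinity>"
        using meas[OF x] by (intro nn_integral_PInf_AE) simp_all
      then show ?case using AE_space
      proof eventually_elim
        case (elim y)
        show ?case
        proof
          assume "q x y = 0"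
          with elim(1) have "ennreal (q' x y) = 0" by (auto simp: V_def ennreal_mult_eq_top_iff)
          with is_channelD(2)[OF q'R, of x y] x elim(2) show "q' x y = 0" by (simp add: ennreal_eq_0_iff)
        qed
      qed
    qed
    show "AE x in \<mu>. integrable \<Lambda> (\<lambda>y. q' x y * log b (q x y / marginal q y))"
      using sA AE_space
    proof eventually_elim
      case (elim x)
      then have x: "x \<in> \<X> i" by (simp add: sp\<mu>)
      have "(\<integral>\<^sup>+y. ennreal (norm (q' x y * L x y)) \<partial>\<Lambda>) \<le> (\<integral>\<^sup>+y. ennreal (q' x y) * V x y \<partial>\<Lambda>)"
        using is_channelD(2)[OF q'R, of x] x
        by (intro nn_integral_mono) (simp add: V_def abs_mult ennreal_mult' mult_left_mono)
      also have "\<dots> < \<infinity>" using elim(1) N_eq[OF x] by (auto simp: A_def)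
      finally have "integrable \<Lambda> (\<lambda>y. q' x y * L x y)"
        using meas[OF x] by (intro integrableI_bounded) simp_all
      then show ?case by (simp add: L_def)
    qed
    show "AE x in \<mu>. (\<integral>y. info_density b \<mu> q x y \<partial>\<Lambda>) \<le> (\<integral>y. q' x y * log b (q x y / marginal q y) \<partial>\<Lambda>)"
      using sA AE_space
    proof eventually_elim
      case (elim x)
      then have x: "x \<in> \<X> i" by (simp add: sp\<mu>)
      have "G x \<le> h (s x)" using elim(1) si[OF x] by (simp add: A_def)
      then show ?case by (simp add: G_def h_def q'_def L_def si[OF x])
    qed
  qed
  ultimately show ?thesis by blast
qed

theorem theorem2:
  fixes n :: nat
    and \<X> :: "nat \<Rightarrow> 'a::euclidean_space set"
    and \<Y> :: "'b::euclidean_space set"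
    and p :: "(nat \<Rightarrow> 'a) \<Rightarrow> 'b \<Rightarrow> real"
    and b C1 :: real
  assumes "n \<ge> 1"
    and "\<And>i. i \<in> {1..n} \<Longrightarrow> \<X> i \<noteq> {} \<and> fsigma (\<X> i)"
    and "\<Y> \<in> sets borel"
    and "b > 1"
    and "is_channel (data_space \<X> {1..n}) \<Y> p"
    and "is_max_of (ereal C1) (individual_infos b n \<X> \<Y> p)"
    and "continuous_on (\<Y> \<times> PiE {1..n} \<X>) (\<lambda>(y, x). p x y)"
  shows "(\<forall>i\<in>{1..n}. selection_channels n \<X> \<Y> p i \<subseteq> averaged_channels n \<X> \<Y> p i) \<and>
         is_max_of (ereal C1) (channel_infos b n \<X> \<Y> (selection_channels n \<X> \<Y> p))"
proof -
  have sub: "selection_channels n \<X> \<Y> p i \<subseteq> averaged_channels n \<X> \<Y> p i" if "i \<in> {1..n}" for i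
    by (rule selection_subset_averaged[OF that assms(2,5,7)])
  then have "channel_infos b n \<X> \<Y> (selection_channels n \<X> \<Y> p) \<subseteq> individual_infos b n \<X> \<Y> p"
    unfolding individual_infos_eq_channel_infos channel_infos_def by blast
  with assms(6) have upper: "v \<le> ereal C1" if "v \<in> channel_infos b n \<X> \<Y> (selection_channels n \<X> \<Y> p)" for v
    using that unfolding is_max_of_def by blast
  from assms(6) have "ereal C1 \<in> individual_infos b n \<X> \<Y> p" unfolding is_max_of_def by blast
  then obtain i \<mu> \<kappa> q where i: "i \<in> {1..n}" and C1: "ereal C1 = mutual_info b \<Y> \<mu> q"
    and \<mu>: "\<mu> \<in> prob_dists (record_space \<X> i)"
    and \<kappa>: "\<kappa> \<in> record_space \<X> i \<rightarrow>\<^sub>M prob_algebra (data_space \<X> ({1..n} - {i}))"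
    and avg: "averages_to \<X> \<Y> p i \<kappa> q"
    unfolding individual_infos_def factorizes_def by blast
  \<comment> \<open>\<open>C1\<close> is a real number, so the maximizing pair has finite
    information, as the linearization at \<open>q\<close> requires.\<close>
  have "mutual_info b \<Y> \<mu> q \<noteq> \<infinity>" unfolding C1[symmetric] by simp
  from selection_dominates_average[OF i assms(2-5) \<mu> \<kappa> avg this]
  obtain q' where q': "q' \<in> selection_channels n \<X> \<Y> p i" "ereal C1 \<le> mutual_info b \<Y> \<mu> q'"
    unfolding C1 by blast
  have mem: "mutual_info b \<Y> \<mu> q' \<in> channel_infos b n \<X> \<Y> (selection_channels n \<X> \<Y> p)"
    using i \<mu> q'(1) unfolding channel_infos_def by blast
  \<comment> \<open>The value for \<open>q'\<close> with the same \<open>\<mu>\<close> is at least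
    \<open>C1\<close> by domination and at most \<open>C1\<close> by the inclusion, so the maximum
    is attained.\<close>
  with upper[OF mem] q'(2) have "ereal C1 \<in> channel_infos b n \<X> \<Y> (selection_channels n \<X> \<Y> p)"
    by (metis order.antisym)
  with sub upper show ?thesis unfolding is_max_of_def by blast
qed

end
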